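(* There are infinitely many essentially distinct pairs $(\pi_1,\pi_2)$ of double covers $\pi_1\colon E_1\to\mathbb{P}^1$, $\pi_2\colon E_2\to\mathbb{P}^1$, where $E_1,E_2$ are elliptic curves over $\mathbb{C}$, the origin of $E_j$ is a ramification point of $\pi_j$ $(j=1,2)$, and $\pi_1(E_1[2])\neq\pi_2(E_2[2])$, such that \[ \#\bigl(\pi_1(E_{1,\mathrm{tors}})\cap\pi_2(E_{2,\mathrm{tors}})\bigr)\ \ge\ 22 . \]
   Context: $E_{j,\mathrm{tors}}$ denotes the set of torsion points of $E_j$. Pairs $(\pi_1,\pi_2)$ and $(\tilde\pi_1,\tilde\pi_2)$, with $\tilde\pi_j\colon\tilde E_j\to\mathbb{P}^1$, are regarded as essentially the same if there is $\gamma\in\mathrm{PGL}_2(\mathbb{C})=\mathrm{Aut}(\mathbb{P}^1)$ mapping the branch set $\pi_j(E_j[2])$ onto the branch set $\tilde\pi_j(\tilde E_j[2])$ for $j=1,2$, possibly after interchanging the two members of a pair; otherwise they are essentially distinct. When $\pi_1(E_1[2])\neq\pi_2(E_2[2])$ the intersection is known to be finite. *)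

theory Defs
  imports Complex_Main "HOL-Library.Equipollence"
begin

section \<open>The projective line over the complex numbers\<close>

datatype p1 = Fin complex | Infty

text \<open>The point \<open>[u : v]\<close>; only meaningful if \<open>u\<close> and \<open>v\<close> are not both zero.\<close>

definition hpt :: "complex \<Rightarrow> complex \<Rightarrow> p1" where
  "hpt u v = (if v = 0 then Infty else Fin (u / v))"

fun moebius :: "complex \<Rightarrow> complex \<Rightarrow> complex \<Rightarrow> complex \<Rightarrow> p1 \<Rightarrow> p1" where
  "moebius a b c d (Fin z) = hpt (a * z + b) (c * z + d)"
| "moebius a b c d Infty = hpt a c"

definition PGL2 :: "(p1 \<Rightarrow> p1) set" where
  "PGL2 = {moebius a b c d | a b c d. a * d - b * c \<noteq> 0}"


section \<open>Elliptic curves\<close>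

text \<open>
  A complex elliptic curve is given by a smooth Weierstrass equation
  \<open>y\<^sup>2 + a1 x y + a3 y = x\<^sup>3 + a2 x\<^sup>2 + a4 x + a6\<close>,
  together with its unique point at infinity \<open>[0 : 1 : 0]\<close>, which is the origin.
  That point is always smooth, so only the affine points have to be tested.
\<close>

datatype weierstrass =
  Weierstrass (a1: complex) (a2: complex) (a3: complex) (a4: complex) (a6: complex)

datatype point = Origin | Affine complex complex

definition on_affine :: "weierstrass \<Rightarrow> complex \<Rightarrow> complex \<Rightarrow> bool" where
  "on_affine E x y \<longleftrightarrow>
     y^2 + a1 E * x * y + a3 E * y = x^3 + a2 E * x^2 + a4 E * x + a6 E"

definition elliptic_curve :: "weierstrass \<Rightarrow> bool" where
  "elliptic_curve E \<longleftrightarrow>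
     (\<forall>x y. on_affine E x y \<longrightarrow>
        \<not> (a1 E * y - (3 * x^2 + 2 * a2 E * x + a4 E) = 0 \<and>
           2 * y + a1 E * x + a3 E = 0))"

definition points :: "weierstrass \<Rightarrow> point set" where
  "points E = insert Origin {Affine x y | x y. on_affine E x y}"

text \<open>
  The chord-tangent law: \<open>l\<close> is the slope of the line through the two points
  (of the tangent line if they coincide).
\<close>

fun ec_add :: "weierstrass \<Rightarrow> point \<Rightarrow> point \<Rightarrow> point" where
  "ec_add E Origin Q = Q"
| "ec_add E P Origin = P"
| "ec_add E (Affine x1 y1) (Affine x2 y2) =
     (if x1 = x2 \<and> y1 + y2 + a1 E * x2 + a3 E = 0 then Origin
      else
        let l = (if x1 = x2
                 then (3 * x1^2 + 2 * a2 E * x1 + a4 E - a1 E * y1) / (2 * y1 + a1 E * x1 + a3 E)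
                 else (y2 - y1) / (x2 - x1));
            x3 = l^2 + a1 E * l - a2 E - x1 - x2
        in Affine x3 (- (y1 + l * (x3 - x1)) - a1 E * x3 - a3 E))"

definition ec_mult :: "weierstrass \<Rightarrow> nat \<Rightarrow> point \<Rightarrow> point" where
  "ec_mult E n P = (ec_add E P ^^ n) Origin"

definition n_torsion :: "weierstrass \<Rightarrow> nat \<Rightarrow> point set" where
  "n_torsion E n = {P \<in> points E. ec_mult E n P = Origin}"

definition torsion :: "weierstrass \<Rightarrow> point set" where
  "torsion E = (\<Union>n\<in>{1..}. n_torsion E n)"


section \<open>Double covers of the projective line\<close>

fun hcoords :: "point \<Rightarrow> complex \<times> complex \<times> complex" where
  "hcoords Origin = (0, 1, 0)"
| "hcoords (Affine x y) = (x, y, 1)"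

text \<open>The value at a point of the ternary form of degree \<open>d\<close> with coefficients \<open>c\<close>.\<close>

definition form :: "nat \<Rightarrow> (nat \<Rightarrow> nat \<Rightarrow> complex) \<Rightarrow> point \<Rightarrow> complex" where
  "form d c P =
     (case hcoords P of (x, y, z) \<Rightarrow>
        \<Sum>i\<le>d. \<Sum>j\<le>d - i. c i j * x^i * y^j * z^(d - i - j))"

text \<open>
  A morphism to the projective line is a map that is given near every point by two forms
  of the same degree without common zero at that point. Values off the curve are irrelevant.
\<close>

definition morphism :: "weierstrass \<Rightarrow> (point \<Rightarrow> p1) \<Rightarrow> bool" where
  "morphism E \<phi> \<longleftrightarrow>
     (\<forall>P\<in>points E. \<exists>d f g.
        (form d f P \<noteq> 0 \<or> form d g P \<noteq> 0) \<and>
        (\<forall>Q\<in>points E. form d f Q \<noteq> 0 \<or> form d g Q \<noteq> 0 \<longrightarrow>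
           \<phi> Q = hpt (form d f Q) (form d g Q)))"

definition fibre :: "weierstrass \<Rightarrow> (point \<Rightarrow> p1) \<Rightarrow> p1 \<Rightarrow> point set" where
  "fibre E \<phi> t = {P \<in> points E. \<phi> P = t}"

text \<open>
  In characteristic zero the degree of a nonconstant morphism is the cardinality of
  all but finitely many of its fibres.
\<close>

definition double_cover :: "weierstrass \<Rightarrow> (point \<Rightarrow> p1) \<Rightarrow> bool" where
  "double_cover E \<phi> \<longleftrightarrow> morphism E \<phi> \<and> finite {t. card (fibre E \<phi> t) \<noteq> 2}"

text \<open>
  The ramification indices over any point of the target of a double cover add up to 2,
  so a point has ramification index greater than 1 exactly if it is alone in its fibre.
\<close>

definition ramified_at :: "weierstrass \<Rightarrow> (point \<Rightarrow> p1) \<Rightarrow> point \<Rightarrow> bool" where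
  "ramified_at E \<phi> P \<longleftrightarrow> fibre E \<phi> (\<phi> P) = {P}"


section \<open>Pairs of double covers\<close>

type_synonym cover = "weierstrass \<times> (point \<Rightarrow> p1)"

definition branch_set :: "cover \<Rightarrow> p1 set" where
  "branch_set C = (case C of (E, \<phi>) \<Rightarrow> \<phi> ` n_torsion E 2)"

definition essentially_same :: "cover \<times> cover \<Rightarrow> cover \<times> cover \<Rightarrow> bool" where
  "essentially_same p q \<longleftrightarrow>
     (\<exists>\<gamma>\<in>PGL2.
        \<gamma> ` branch_set (fst p) = branch_set (fst q) \<and>
        \<gamma> ` branch_set (snd p) = branch_set (snd q) \<or>
        \<gamma> ` branch_set (fst p) = branch_set (snd q) \<and>
        \<gamma> ` branch_set (snd p) = branch_set (fst q))"

end

theory Submission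
  imports Defs "HOL-Algebra.Group" "HOL-Computational_Algebra.Fundamental_Theorem_Algebra"
begin

text \<open>
  For t different from 0 and -4 put E(t): y^2 = x^3 + (3 x - t)^2 and t' = - 4 - t. With the
  coordinates u = t / x on E(t) and u = 4 - t' / x on E(t'), the two abscissa maps share three branch
  points A, B, C and differ in the fourth one, which is 0 or 4. Both can be
  pulled back along the covering of the projective line by itself with group (Z/2)^2 that is branched
  at A, B, C; the curve then covers itself by multiplication by 2. Hence every value u that is a torsion value for
  both curves yields 4 common torsion values upstairs, or 2 if it is A, B or C. The points over
  u = infinity have order 3 on both curves.

  Let V, V1, V2 be the three roots of u (u - 3)^2 = k. Their points on E(t) can be chosen with sum
  zero, and V1 - V2 is the image of the point V of E(t') under an isogeny of degree 3. So if V is a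
  torsion value for both curves then so are V1 and V2, and there are 3 * 2 + 4 * 4 = 22 common values.
  For t' = 4 m^3 and V = m + 1 the point on E(t) has order 3. For real m in (0, 3) the point on E(t')
  moves to the origin as m tends to 3, and the intermediate value theorem gives infinitely many m for
  which it is torsion. The j-invariant, computed from cross ratios of the branch points, takes each
  value for finitely many t, which separates infinitely many of these pairs.
\<close>

section \<open>The group law\<close>

text \<open>Write u (u - 3)^2 = D(u - 2) + 2 with the odd polynomial D(w) = w^3 - 3 w. Hence u -> 4
  - u maps the fibre of u (u - 3)^2 over k to the fibre over 4 - k. Since A, B, C form the fibre
  over - t, this reflection exchanges E(t) and E(t'), and each statement on E(t) at u has a mirror
  image on E(t') at 4 - u. As D commutes with w -> w^2 - 2, the three V are the squares of the roots
  p of p^3 - 3 p = s, where s^2 = k. These p have sum zero, and that is what makes points with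
  abscissa t / p^2 and ordinate proportional to 1 / p^3 collinear.

  That V is a torsion value for both curves is two conditions on (t, V). Points of order 3 satisfy
  the first one along a rational curve, and one real parameter is left for the second.

  Torsion is certified on abscissae alone, since the isogeny and the real argument see nothing else.
  As it is defined by explicit chord and tangent formulas, associativity has to be derived from
  them; it is proved for a generic third point first, which avoids most of the degenerate
  positions.\<close>

declare ec_add.simps(3) [simp del]

fun ec_neg :: "point \<Rightarrow> point" where
  "ec_neg Origin = Origin"
| "ec_neg (Affine x y) = Affine x (- y)"

locale smooth_cubic =
  fixes a b c :: complex
  assumes smooth: "\<And>x. x^3 + a * x^2 + b * x + c = 0 \<Longrightarrow> 3 * x^2 + 2 * a * x + b \<noteq> 0"
begin

definition E :: weierstrass where "E = Weierstrass 0 a 0 b c"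

definition f :: "complex \<Rightarrow> complex" where "f x = x^3 + a * x^2 + b * x + c"

abbreviation add :: "point \<Rightarrow> point \<Rightarrow> point" (infixl "\<oplus>\<^sub>E" 65) where "P \<oplus>\<^sub>E Q \<equiv> ec_add E P Q"

abbreviation curve :: "point set" where "curve \<equiv> points E"

lemma Origin_mem [simp]: "Origin \<in> curve"
  by (simp add: points_def)

lemma Affine_mem [simp]: "Affine x y \<in> curve \<longleftrightarrow> y^2 = f x"
  by (simp add: points_def on_affine_def E_def f_def)

lemma add_Origin [simp]: "Origin \<oplus>\<^sub>E P = P" "P \<oplus>\<^sub>E Origin = P"
  by (cases P; simp)+

lemma add_same_x:
  "Affine x y \<oplus>\<^sub>E Affine x y' =
     (if y + y' = 0 then Origin
      else let l = (3 * x^2 + 2 * a * x + b) / (2 * y); x3 = l^2 - a - 2 * x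
           in Affine x3 (- (y + l * (x3 - x))))"
  by (simp add: ec_add.simps(3) E_def Let_def)

lemma add_chord:
  assumes "x1 \<noteq> x2" "y2 - y1 = l * (x2 - x1)" "x3 = l^2 - a - x1 - x2"
  shows "Affine x1 y1 \<oplus>\<^sub>E Affine x2 y2 = Affine x3 (- (y1 + l * (x3 - x1)))"
proof -
  have "l = (y2 - y1) / (x2 - x1)" using assms by simp
  then show ?thesis using assms by (simp add: ec_add.simps(3) E_def Let_def)
qed

text \<open>The points with abscissae x1, x2, x3 are the intersection of the curve with the line of
  slope l through (x1, y1); tangency is allowed.\<close>

definition line :: "complex \<Rightarrow> complex \<Rightarrow> complex \<Rightarrow> complex \<Rightarrow> complex \<Rightarrow> bool" where
  "line l x1 y1 x2 x3 \<longleftrightarrow>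
     (\<forall>x. f x - (y1 + l * (x - x1))^2 = (x - x1) * (x - x2) * (x - x3))"

text \<open>The choice of x3 makes the coefficients of x^3 and x^2 agree in the identity
  \<open>line\<close>. Two conditions remain: zeros at x1 and x2, or a double zero at x1 for a
  tangent. The last conclusion keeps the slope, which the equation for y2 does not determine if x1 =
  x2.\<close>

lemma add_line:
  assumes "Affine x1 y1 \<in> curve" "Affine x2 y2 \<in> curve"
    and "Affine x1 y1 \<oplus>\<^sub>E Affine x2 y2 \<noteq> Origin"
  obtains l x3 where "Affine x1 y1 \<oplus>\<^sub>E Affine x2 y2 = Affine x3 (- (y1 + l * (x3 - x1)))"
    "line l x1 y1 x2 x3" "y2 = y1 + l * (x2 - x1)" "x3 = l^2 - a - x1 - x2"
    "x1 = x2 \<Longrightarrow> 2 * y1 * l = 3 * x1^2 + 2 * a * x1 + b \<and> y1 \<noteq> 0"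
proof (cases "x1 = x2")
  case True
  then have ne: "y1 + y2 \<noteq> 0" using assms(3) by (auto simp: add_same_x)
  have "(y1 - y2) * (y1 + y2) = 0" using assms True by (simp add: algebra_simps power2_eq_square)
  then have y: "y2 = y1" using ne by simp
  then have y0: "y1 \<noteq> 0" using ne by auto
  define l where "l = (3 * x1^2 + 2 * a * x1 + b) / (2 * y1)"
  define x3 where "x3 = l^2 - a - x1 - x2"
  have l: "2 * y1 * l = 3 * x1^2 + 2 * a * x1 + b" using y0 by (simp add: l_def)
  have "line l x1 y1 x2 x3"
    unfolding line_def
  proof
    fix x
    have "f x - (y1 + l * (x - x1))^2 - (x - x1) * (x - x2) * (x - x3)
       = (f x1 - y1^2) + (x - x1) * (3 * x1^2 + 2 * a * x1 + b - 2 * y1 * l)"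
      unfolding True[symmetric] x3_def f_def by algebra
    then show "f x - (y1 + l * (x - x1))^2 = (x - x1) * (x - x2) * (x - x3)" using l assms by simp
  qed
  moreover have "Affine x1 y1 \<oplus>\<^sub>E Affine x2 y2 = Affine x3 (- (y1 + l * (x3 - x1)))"
    using True y y0 by (simp add: add_same_x l_def x3_def Let_def)
  ultimately show ?thesis using that[of x3 l] True y l y0 x3_def by auto
next
  case False
  define l where "l = (y2 - y1) / (x2 - x1)"
  define x3 where "x3 = l^2 - a - x1 - x2"
  have l: "y2 - y1 = l * (x2 - x1)" using False by (simp add: l_def)
  have y2: "y2 = y1 + l * (x2 - x1)" using l by (simp add: algebra_simps)
  have e: "f x1 = y1^2" "f x2 = (y1 + l * (x2 - x1))^2" using assms y2 by auto
  have "line l x1 y1 x2 x3"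
    unfolding line_def
  proof
    fix x
    \<comment> \<open>The difference of the two sides is linear in x and is interpolated from its
      values at x1 and x2.\<close>
    have "(x2 - x1) * (f x - (y1 + l * (x - x1))^2 - (x - x1) * (x - x2) * (x - x3))
       = (x2 - x) * (f x1 - y1^2) + (x - x1) * (f x2 - (y1 + l * (x2 - x1))^2)"
      unfolding x3_def f_def by algebra
    then show "f x - (y1 + l * (x - x1))^2 = (x - x1) * (x - x2) * (x - x3)" using e False by simp
  qed
  then show ?thesis using that[of x3 l] False y2 x3_def add_chord[OF False l x3_def] by auto
qed

lemma add_closed:
  assumes "P \<in> curve" "Q \<in> curve" shows "P \<oplus>\<^sub>E Q \<in> curve"
proof (cases "P \<oplus>\<^sub>E Q = Origin")
  case False
  show ?thesis
  proof (cases P; cases Q)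
    fix x1 y1 x2 y2 assume PQ: "P = Affine x1 y1" "Q = Affine x2 y2"
    from assms False obtain l x3 where A: "P \<oplus>\<^sub>E Q = Affine x3 (- (y1 + l * (x3 - x1)))"
      and "line l x1 y1 x2 x3" unfolding PQ by (rule add_line)
    then have "f x3 = (y1 + l * (x3 - x1))^2" unfolding line_def by (metis diff_self eq_iff_diff_eq_0 mult_zero_right)
    then show ?thesis unfolding A by (simp add: power2_eq_square algebra_simps)
  qed (use assms in auto)
qed simp

lemma neg_closed: "P \<in> curve \<Longrightarrow> ec_neg P \<in> curve"
  by (cases P) auto

lemma neg_neg [simp]: "ec_neg (ec_neg P) = P"
  by (cases P) auto

lemma add_neg: "P \<oplus>\<^sub>E ec_neg P = Origin" "ec_neg P \<oplus>\<^sub>E P = Origin"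
  by (cases P; simp add: add_same_x)+

lemma add_eq_Origin: "P \<in> curve \<Longrightarrow> Q \<in> curve \<Longrightarrow> P \<oplus>\<^sub>E Q = Origin \<Longrightarrow> Q = ec_neg P"
  by (cases P; cases Q) (auto simp: ec_add.simps(3) E_def Let_def eq_neg_iff_add_eq_0 add.commute split: if_splits)

lemma add_comm:
  assumes "P \<in> curve" "Q \<in> curve" shows "P \<oplus>\<^sub>E Q = Q \<oplus>\<^sub>E P"
proof (cases P; cases Q)
  fix x1 y1 x2 y2 assume PQ: "P = Affine x1 y1" "Q = Affine x2 y2"
  show ?thesis
  proof (cases "x1 = x2")
    case True
    have "(y1 - y2) * (y1 + y2) = 0" using assms PQ True by (simp add: algebra_simps power2_eq_square)
    then have "y1 = y2 \<or> y1 + y2 = 0" by auto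
    then show ?thesis using PQ True by (auto simp: add_same_x add.commute)
  next
    case False
    define l where "l = (y2 - y1) / (x2 - x1)"
    have l: "y2 - y1 = l * (x2 - x1)" using False by (simp add: l_def)
    then have l': "y1 - y2 = l * (x1 - x2)" by (simp add: algebra_simps)
    show ?thesis unfolding PQ add_chord[OF False l refl] add_chord[OF False[symmetric] l' refl]
      using l by (simp add: algebra_simps)
  qed
qed auto

section \<open>Associativity of the chord-tangent law\<close>

fun abscissa :: "point \<Rightarrow> complex" where
  "abscissa (Affine x y) = x" | "abscissa Origin = 0"

text \<open>\<open>abscissa\<close> has the default value 0 at \<open>Origin\<close>, hence the
  separate disjunct. The exceptional sets of the generic arguments are built from sets of this
  kind.\<close>

lemma finite_abscissa: "finite {P \<in> curve. P = Origin \<or> abscissa P \<in> X}" if "finite X"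
proof -
  have *: "{P \<in> curve. P = Origin \<or> abscissa P \<in> X} \<subseteq>
     insert Origin (\<Union>x\<in>X. {Affine x (csqrt (f x)), Affine x (- csqrt (f x))})"
  proof
    fix P assume P: "P \<in> {P \<in> curve. P = Origin \<or> abscissa P \<in> X}"
    show "P \<in> insert Origin (\<Union>x\<in>X. {Affine x (csqrt (f x)), Affine x (- csqrt (f x))})"
    proof (cases P)
      case (Affine x y)
      then have "y^2 = (csqrt (f x))^2" "x \<in> X" using P by auto
      then have "y = csqrt (f x) \<or> y = - csqrt (f x)" by (simp only: power2_eq_iff)
      then show ?thesis using Affine \<open>x \<in> X\<close> by blast
    qed simp
  qed
  show ?thesis by (rule finite_subset[OF *]) (use that in auto)
qed

lemma infinite_curve: "infinite curve"
proof
  assume "finite curve"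
  then have "finite (abscissa ` curve)" by simp
  moreover have "x \<in> abscissa ` curve" for x
    by (rule image_eqI[where x = "Affine x (csqrt (f x))"]) auto
  then have "abscissa ` curve = UNIV" by auto
  ultimately show False using infinite_UNIV_char_0[where 'a = complex] by simp
qed

text \<open>The line through B and S has the third point - (B + S). Its mirror image passes through
  - B and B + S and has the third point - S, so the sum is S without any appeal to
  associativity.\<close>

lemma cancel_generic:
  assumes "B \<in> curve" "S \<in> curve" "S \<noteq> Origin" "abscissa S \<noteq> abscissa B \<or> B = Origin"
  shows "ec_neg B \<oplus>\<^sub>E (B \<oplus>\<^sub>E S) = S"
proof (cases B; cases S)
  fix x1 y1 x2 y2 assume BS: "B = Affine x1 y1" "S = Affine x2 y2"
  then have ne: "x1 \<noteq> x2" using assms by auto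
  have "B \<oplus>\<^sub>E S \<noteq> Origin" using ne by (simp add: BS ec_add.simps(3) E_def Let_def)
  then obtain l x3 where A: "B \<oplus>\<^sub>E S = Affine x3 (- (y1 + l * (x3 - x1)))"
     and ln: "line l x1 y1 x2 x3" and y2: "y2 = y1 + l * (x2 - x1)" and x3: "x3 = l^2 - a - x1 - x2"
    using add_line[of x1 y1 x2 y2] assms BS by metis
  show ?thesis
  proof (cases "x3 = x1")
    case False
    have "ec_neg B \<oplus>\<^sub>E (B \<oplus>\<^sub>E S) = Affine x2 (- (- y1 + (- l) * (x2 - x1)))"
      unfolding A unfolding BS ec_neg.simps
      by (rule add_chord) (use False x3 in \<open>auto simp: algebra_simps\<close>)
    then show ?thesis using y2 BS by simp
  next
    case True
    have f1: "f x1 = y1^2" using assms BS by simp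
    have l: "3 * x1^2 + 2 * a * x1 + b = 2 * y1 * l"
    proof -
      \<comment> \<open>Here x1 is a double zero, so the mirrored line is a tangent. Its slope comes
        from the derivative at x1, extracted from the values at x1 + 1 and x1 - 1.\<close>
      have *: "f (x1 + 1) - (y1 + l * 1)^2 = 1 * (x1 + 1 - x2) * 1"
        "f (x1 - 1) - (y1 - l * 1)^2 = 1 * (x1 - 1 - x2)"
        using ln[unfolded line_def True, rule_format, of "x1 + 1"]
          ln[unfolded line_def True, rule_format, of "x1 - 1"] by simp_all
      show ?thesis using * f1 x3 True unfolding f_def by algebra
    qed
    have y1: "y1 \<noteq> 0" using smooth[of x1] f1 l unfolding f_def by auto
    have "ec_neg B \<oplus>\<^sub>E (B \<oplus>\<^sub>E S) = Affine x2 (- (- y1 + (- l) * (x2 - x1)))"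
      unfolding A unfolding BS ec_neg.simps True using y1 l x3 True
      by (simp add: add_same_x Let_def)
    then show ?thesis using y2 BS by simp
  qed
qed (use assms in auto)

text \<open>If l and n are the slopes of the lines through A, B and through B, S, then g - l and g - n
  with g = (xA - xS) / (l - n) are those of the lines through A + B, S and through A, B + S.\<close>

lemma assoc_generic_affine:
  assumes A: "A = Affine xA yA" "A \<in> curve" and B: "B = Affine xB yB" "B \<in> curve"
    and S: "S = Affine xS yS" "S \<in> curve"
    and AB: "A \<oplus>\<^sub>E B \<noteq> Origin"
    and gen: "xS \<noteq> xA" "xS \<noteq> xB" "xS \<noteq> abscissa (A \<oplus>\<^sub>E B)" "xA \<noteq> abscissa (B \<oplus>\<^sub>E S)"
  shows "(A \<oplus>\<^sub>E B) \<oplus>\<^sub>E S = A \<oplus>\<^sub>E (B \<oplus>\<^sub>E S)"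
proof -
  have BA: "B \<oplus>\<^sub>E A \<noteq> Origin" using AB add_comm[OF A(2) B(2)] by simp
  obtain l xC where C: "B \<oplus>\<^sub>E A = Affine xC (- (yB + l * (xC - xB)))"
     and ln: "line l xB yB xA xC" and yA: "yA = yB + l * (xA - xB)" and xC: "xC = l^2 - a - xB - xA"
     and tan: "xB = xA \<Longrightarrow> 2 * yB * l = 3 * xB^2 + 2 * a * xB + b \<and> yB \<noteq> 0"
    using add_line[of xB yB xA yA] A B BA by metis
  have C': "A \<oplus>\<^sub>E B = Affine xC (- (yB + l * (xC - xB)))" using C add_comm[OF A(2) B(2)] by simp
  have "B \<oplus>\<^sub>E S \<noteq> Origin" using gen by (simp add: B S ec_add.simps(3) E_def Let_def)
  then obtain n xD where D: "B \<oplus>\<^sub>E S = Affine xD (- (yB + n * (xD - xB)))"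
     and nn: "line n xB yB xS xD" and yS: "yS = yB + n * (xS - xB)" and xD: "xD = n^2 - a - xB - xS"
    using add_line[of xB yB xS yS] B S by metis
  have gC: "xS \<noteq> xC" and gD: "xA \<noteq> xD" using gen C' D by auto
  have fS: "f xS = yS^2" and fA: "f xA = yA^2" and fB: "f xB = yB^2" using S A B by auto
  have L: "yS^2 - (yB + l * (xS - xB))^2 = (xS - xB) * (xS - xA) * (xS - xC)"
    using ln[unfolded line_def, rule_format, of xS] fS by simp
  have N: "yA^2 - (yB + n * (xA - xB))^2 = (xA - xB) * (xA - xS) * (xA - xD)"
    using nn[unfolded line_def, rule_format, of xA] fA by simp
  have lnne: "l \<noteq> n"
  proof
    assume "l = n"
    then have "(xS - xB) * (xS - xA) * (xS - xC) = 0" using L yS by simp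
    then show False using gen gC by simp
  qed
  define g where "g = (xA - xS) / (l - n)"
  have g: "g * (l - n) = xA - xS" using lnne by (simp add: g_def)
  have "(xS - xB) * ((yS + (yB + l * (xS - xB))) * (l - n) - (xA - xS) * (xS - xC)) = 0"
    using L yS by algebra
  then have "(yS + (yB + l * (xS - xB))) * (l - n) = (xA - xS) * (xS - xC)" using gen by simp
  then have "(l - n) * (yS + (yB + l * (xS - xB)) - g * (xS - xC)) = 0" using g by algebra
  then have s1: "yS + (yB + l * (xS - xB)) = g * (xS - xC)" using lnne by simp
  have "(yA + (yB + n * (xA - xB))) * (n - l) = (xS - xA) * (xA - xD)"
  proof (cases "xA = xB")
    case False
    have "(xA - xB) * ((yA + (yB + n * (xA - xB))) * (n - l) - (xS - xA) * (xA - xD)) = 0"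
      using N yA by algebra
    then show ?thesis using False by simp
  next
    case True
    \<comment> \<open>\<open>N\<close> reads 0 = 0 here and cannot be divided by xA - xB. The
      tangent slope l and the value of the second line identity at xB + 1 take its place.\<close>
    have t: "2 * yB * l = 3 * xB^2 + 2 * a * xB + b" using tan True by simp
    have *: "f (xB + 1) - (yB + n * 1)^2 = 1 * (xB + 1 - xS) * (xB + 1 - xD)"
      using nn[unfolded line_def, rule_format, of "xB + 1"] by simp
    have "2 * yB * (n - l) = (xS - xB) * (xB - xD)"
      using * t fB xD unfolding f_def by algebra
    then show ?thesis using True yA by simp
  qed
  then have "(l - n) * (yA + (yB + n * (xA - xB)) - g * (xA - xD)) = 0" using g by algebra
  then have s2: "yA + (yB + n * (xA - xB)) = g * (xA - xD)" using lnne by simp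
  define xE where "xE = (g - l)^2 - a - xC - xS"
  have xE': "xE = (g - n)^2 - a - xA - xD" unfolding xE_def xC xD using g by algebra
  have e1: "(A \<oplus>\<^sub>E B) \<oplus>\<^sub>E S = Affine xE (- (- (yB + l * (xC - xB)) + (g - l) * (xE - xC)))"
    unfolding C' S by (rule add_chord) (use gC s1 xE_def in \<open>auto simp: algebra_simps\<close>)
  have e2: "A \<oplus>\<^sub>E (B \<oplus>\<^sub>E S) = Affine xE (- (yA + (g - n) * (xE - xA)))"
    unfolding D A by (rule add_chord) (use gD s2 xE' in \<open>auto simp: algebra_simps\<close>)
  have "- (yB + l * (xC - xB)) + (g - l) * (xE - xC) = yA + (g - n) * (xE - xA)"
  proof -
    have xE: "xE = g^2 - 2 * g * l + xA + xB - xS" unfolding xE_def xC by algebra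
    have "- (yB + l * (xC - xB)) + (g - l) * (xE - xC) = yS + (g - l) * (xE - xS)"
      using s1 by algebra
    moreover have "yS + (g - l) * (xE - xS) - (yA + (g - n) * (xE - xA)) = (2 * l - g) * (g * (l - n) - (xA - xS))"
      unfolding xE yA yS by algebra
    ultimately show ?thesis using g by simp
  qed
  then show ?thesis using e1 e2 by simp
qed

lemma finite_translate:
  assumes "B \<in> curve" "finite X"
  shows "finite {S \<in> curve. B \<oplus>\<^sub>E S \<in> X}"
proof (rule finite_subset)
  show "{S \<in> curve. B \<oplus>\<^sub>E S \<in> X} \<subseteq> {S \<in> curve. S = Origin \<or> abscissa S \<in> {abscissa B}} \<union> (\<lambda>Q. ec_neg B \<oplus>\<^sub>E Q) ` X"
  proof
    fix S assume S: "S \<in> {S \<in> curve. B \<oplus>\<^sub>E S \<in> X}"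
    show "S \<in> {S \<in> curve. S = Origin \<or> abscissa S \<in> {abscissa B}} \<union> (\<lambda>Q. ec_neg B \<oplus>\<^sub>E Q) ` X"
    proof (cases "S = Origin \<or> abscissa S = abscissa B")
      case False
      then have "ec_neg B \<oplus>\<^sub>E (B \<oplus>\<^sub>E S) = S" using cancel_generic[of B S] S assms by auto
      then show ?thesis using S by (metis (mono_tags, lifting) UnI2 image_eqI mem_Collect_eq)
    qed (use S in auto)
  qed
qed (use finite_abscissa[of "{abscissa B}"] assms in auto)

lemma assoc_generic:
  assumes A: "A \<in> curve" and B: "B \<in> curve"
  shows "finite {S \<in> curve. (A \<oplus>\<^sub>E B) \<oplus>\<^sub>E S \<noteq> A \<oplus>\<^sub>E (B \<oplus>\<^sub>E S)}"
proof -
  let ?X = "{abscissa A, abscissa B, abscissa (A \<oplus>\<^sub>E B)}"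
  let ?Y = "{P \<in> curve. P = Origin \<or> abscissa P \<in> ?X}"
  let ?Z = "{S \<in> curve. B \<oplus>\<^sub>E S \<in> {P \<in> curve. P = Origin \<or> abscissa P \<in> {abscissa A}}}"
  have fin: "finite (?Y \<union> ?Z)"
    using finite_abscissa[of ?X] finite_translate[OF B finite_abscissa[of "{abscissa A}"]] by auto
  moreover have "{S \<in> curve. (A \<oplus>\<^sub>E B) \<oplus>\<^sub>E S \<noteq> A \<oplus>\<^sub>E (B \<oplus>\<^sub>E S)} \<subseteq> ?Y \<union> ?Z"
  proof (rule subsetI, rule ccontr)
    fix S assume S: "S \<in> {S \<in> curve. (A \<oplus>\<^sub>E B) \<oplus>\<^sub>E S \<noteq> A \<oplus>\<^sub>E (B \<oplus>\<^sub>E S)}" and n: "S \<notin> ?Y \<union> ?Z"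
    then have Sm: "S \<in> curve" and ne: "(A \<oplus>\<^sub>E B) \<oplus>\<^sub>E S \<noteq> A \<oplus>\<^sub>E (B \<oplus>\<^sub>E S)"
      and Sx: "S \<noteq> Origin" "abscissa S \<notin> ?X" by auto
    have D: "abscissa (B \<oplus>\<^sub>E S) \<noteq> abscissa A" using n Sm add_closed[OF B Sm] by auto
    have AO: "A \<noteq> Origin" and BO: "B \<noteq> Origin" using ne by auto
    show False
    proof (cases "A \<oplus>\<^sub>E B = Origin")
      case True
      then have BA: "A = ec_neg B" using add_eq_Origin[OF A B] by simp
      then show False using ne True cancel_generic[OF B Sm] Sx by simp
    next
      case False
      obtain xA yA xB yB xS yS where "A = Affine xA yA" "B = Affine xB yB" "S = Affine xS yS"
        using AO BO Sx by (metis point.exhaust)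
      then show False using assoc_generic_affine[OF _ A _ B _ Sm False] Sx D ne by auto
    qed
  qed
  ultimately show ?thesis by (rule rev_finite_subset)
qed

text \<open>The two sides are compared after adding a generic S. Moving the brackets then needs
  associativity only for four fixed pairs, each with a generic last argument, and S is finally
  removed by \<open>cancel_generic\<close>.\<close>

lemma add_assoc:
  assumes A: "A \<in> curve" and B: "B \<in> curve" and C: "C \<in> curve"
  shows "(A \<oplus>\<^sub>E B) \<oplus>\<^sub>E C = A \<oplus>\<^sub>E (B \<oplus>\<^sub>E C)"
proof -
  let ?P = "(A \<oplus>\<^sub>E B) \<oplus>\<^sub>E C" and ?Q = "A \<oplus>\<^sub>E (B \<oplus>\<^sub>E C)"
  have AB: "A \<oplus>\<^sub>E B \<in> curve" and BC: "B \<oplus>\<^sub>E C \<in> curve" using assms add_closed by auto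
  have P: "?P \<in> curve" and Q: "?Q \<in> curve" using assms AB BC add_closed by auto
  let ?bad = "\<lambda>A B. {S \<in> curve. (A \<oplus>\<^sub>E B) \<oplus>\<^sub>E S \<noteq> A \<oplus>\<^sub>E (B \<oplus>\<^sub>E S)}"
  let ?X = "?bad (A \<oplus>\<^sub>E B) C \<union> {S \<in> curve. C \<oplus>\<^sub>E S \<in> ?bad A B} \<union> ?bad B C \<union> ?bad A (B \<oplus>\<^sub>E C)
     \<union> {S \<in> curve. S = Origin \<or> abscissa S \<in> {abscissa ?P, abscissa ?Q}}"
  have "finite ?X"
    by (intro finite_UnI assoc_generic[OF AB C] finite_translate[OF C assoc_generic[OF A B]]
      assoc_generic[OF B C] assoc_generic[OF A BC] finite_abscissa) simp
  then have "infinite (curve - ?X)" by (rule Diff_infinite_finite) (rule infinite_curve)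
  then have "curve - ?X \<noteq> {}" by (rule infinite_imp_nonempty)
  then obtain S where S: "S \<in> curve" "S \<notin> ?X" by (elim ex_in_conv[THEN iffD2, THEN exE] DiffE)
  have CS: "C \<oplus>\<^sub>E S \<in> curve" using C S add_closed by auto
  have "?P \<oplus>\<^sub>E S = (A \<oplus>\<^sub>E B) \<oplus>\<^sub>E (C \<oplus>\<^sub>E S)" using S by simp
  also have "\<dots> = A \<oplus>\<^sub>E (B \<oplus>\<^sub>E (C \<oplus>\<^sub>E S))" using S CS by simp
  also have "B \<oplus>\<^sub>E (C \<oplus>\<^sub>E S) = (B \<oplus>\<^sub>E C) \<oplus>\<^sub>E S" using S by simp
  also have "A \<oplus>\<^sub>E \<dots> = ?Q \<oplus>\<^sub>E S" using S by simp
  finally have PQ: "S \<oplus>\<^sub>E ?P = S \<oplus>\<^sub>E ?Q" using add_comm S P Q by simp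
  have cancel: "ec_neg S \<oplus>\<^sub>E (S \<oplus>\<^sub>E R) = R" if "R \<in> {?P, ?Q}" for R
  proof (cases "R = Origin")
    case True then show ?thesis by (simp add: add_neg)
  next
    case False
    then show ?thesis using cancel_generic[of S R] S P Q that by auto
  qed
  have "?P = ec_neg S \<oplus>\<^sub>E (S \<oplus>\<^sub>E ?P)" by (rule cancel[symmetric]) simp
  also have "\<dots> = ec_neg S \<oplus>\<^sub>E (S \<oplus>\<^sub>E ?Q)" by (simp only: PQ)
  also have "\<dots> = ?Q" by (rule cancel) simp
  finally show ?thesis .
qed

section \<open>The group and its torsion points\<close>

definition G :: "point monoid" where
  "G = \<lparr>carrier = curve, monoid.mult = ec_add E, one = Origin\<rparr>"

lemma G_simps [simp]: "carrier G = curve" "P \<otimes>\<^bsub>G\<^esub> Q = P \<oplus>\<^sub>E Q" "\<one>\<^bsub>G\<^esub> = Origin"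
  by (simp_all add: G_def)

lemma comm_group_G: "comm_group G"
  by (rule comm_groupI) (use neg_closed add_neg(2) in \<open>auto simp: add_closed add_assoc intro: add_comm\<close>)

end

sublocale smooth_cubic \<subseteq> G: comm_group G
  by (rule comm_group_G)

context smooth_cubic
begin

lemma ec_mult_eq_pow: "P \<in> curve \<Longrightarrow> ec_mult E n P = P [^]\<^bsub>G\<^esub> n"
proof (induction n)
  case (Suc n)
  then show ?case using G.nat_pow_Suc2[of P n] by (simp add: ec_mult_def)
qed (simp add: ec_mult_def)

lemma torsion_iff: "P \<in> torsion E \<longleftrightarrow> P \<in> curve \<and> (\<exists>n>0. P [^]\<^bsub>G\<^esub> (n::nat) = Origin)"
  by (force simp: torsion_def n_torsion_def ec_mult_eq_pow Suc_le_eq)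

lemma torsion_add:
  assumes "P \<in> torsion E" "Q \<in> torsion E"
  shows "P \<oplus>\<^sub>E Q \<in> torsion E"
proof -
  obtain n m :: nat where *: "n > 0" "P [^]\<^bsub>G\<^esub> n = Origin" "m > 0" "Q [^]\<^bsub>G\<^esub> m = Origin"
    and PQ: "P \<in> carrier G" "Q \<in> carrier G"
    using assms by (auto simp: torsion_iff)
  have 1: "P [^]\<^bsub>G\<^esub> (n * m) = Origin" using G.nat_pow_pow[OF PQ(1), of n m] * G.nat_pow_one[of m] by simp
  have 2: "Q [^]\<^bsub>G\<^esub> (n * m) = Origin" using G.nat_pow_pow[OF PQ(2), of m n] * G.nat_pow_one[of n] by (simp add: mult.commute)
  have "(P \<oplus>\<^sub>E Q) [^]\<^bsub>G\<^esub> (n * m) = Origin" using G.nat_pow_distrib[OF PQ, of "n * m"] 1 2 by simp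
  then show ?thesis using * PQ add_closed by (auto simp: torsion_iff intro!: exI[of _ "n * m"])
qed

lemma torsion_neg: "P \<in> torsion E \<Longrightarrow> ec_neg P \<in> torsion E"
proof -
  assume P: "P \<in> torsion E"
  then have Pc: "P \<in> carrier G" by (auto simp: torsion_iff)
  have "ec_neg P = inv\<^bsub>G\<^esub> P"
    using G.inv_equality[of "ec_neg P" P] Pc add_neg neg_closed by simp
  then have "ec_neg P [^]\<^bsub>G\<^esub> n = Origin" if "P [^]\<^bsub>G\<^esub> n = Origin" for n :: nat
    using that G.nat_pow_inv[OF Pc, of n] G.inv_one by simp
  then show ?thesis using P neg_closed by (auto simp: torsion_iff)
qed

lemma torsion_half:
  assumes "P \<in> curve" "P \<oplus>\<^sub>E P \<in> torsion E"
  shows "P \<in> torsion E"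
proof -
  obtain n :: nat where n: "n > 0" "(P \<oplus>\<^sub>E P) [^]\<^bsub>G\<^esub> n = Origin" using assms by (auto simp: torsion_iff)
  have "P [^]\<^bsub>G\<^esub> (2::nat) = P \<oplus>\<^sub>E P" using assms by (simp add: numeral_2_eq_2)
  then have "P [^]\<^bsub>G\<^esub> (2 * n) = Origin" using G.nat_pow_pow[of P 2 n] n assms by simp
  then show ?thesis using n assms by (auto simp: torsion_iff intro!: exI[of _ "2 * n"])
qed

lemma Origin_torsion [simp]: "Origin \<in> torsion E"
  using G.nat_pow_one[of 1] by (auto simp: torsion_iff intro!: exI[of _ 1])

lemma double_abscissa:
  assumes "y^2 = f x" "y \<noteq> 0"
  obtains y' where "Affine x y \<oplus>\<^sub>E Affine x y = Affine ((3 * x^2 + 2 * a * x + b)^2 / (4 * f x) - a - 2 * x) y'"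
proof -
  have "((3 * x^2 + 2 * a * x + b) / (2 * y))^2 = (3 * x^2 + 2 * a * x + b)^2 / (4 * f x)"
    unfolding assms(1)[symmetric] by (simp add: power_divide power_mult_distrib)
  then show ?thesis using assms(2) that by (simp add: add_same_x Let_def)
qed

lemma torsion_of_order_two: "Affine x y \<in> curve \<Longrightarrow> y = 0 \<Longrightarrow> Affine x y \<in> torsion E"
  by (rule torsion_half) (auto simp: add_same_x)

end

section \<open>Plane cubics with a rational point of order three\<close>

text \<open>For b different from 0, the lines y = 3 x - b and y = b - 3 x meet the curve y^2 =
  \<open>flex_cubic b x\<close> only at x = 0, with multiplicity 3. The two points there are flexes
  and have order 3.\<close>

definition flex_cubic :: "complex \<Rightarrow> complex \<Rightarrow> complex" where
  "flex_cubic b x = x^3 + (3 * x - b)^2"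

definition flex_double :: "complex \<Rightarrow> complex \<Rightarrow> complex" where
  "flex_double b x = x * (x^3 + 12 * b * x - 8 * b^2) / (4 * flex_cubic b x)"

text \<open>The abscissa of the isogeny of degree 3 from the curve with parameter b, whose kernel is
  generated by the flex with abscissa 0, to the curve with parameter - 4 - b.\<close>

definition flex_isogeny :: "complex \<Rightarrow> complex \<Rightarrow> complex" where
  "flex_isogeny b x = - (x^3 + 12 * x^2 - 12 * b * x + 4 * b^2) / (3 * x^2)"

text \<open>A certificate of torsion without ordinates. Rule \<open>three\<close> leaves 2 P = P or
  2 P = - P. Rule \<open>two\<close> is separate because \<open>flex_double\<close> divides by zero
  at the points of order 2.\<close>

inductive division_abscissa :: "complex \<Rightarrow> complex \<Rightarrow> bool" for b where
  two: "flex_cubic b x = 0 \<Longrightarrow> division_abscissa b x"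
| three: "flex_double b x = x \<Longrightarrow> division_abscissa b x"
| halve: "division_abscissa b (flex_double b x) \<Longrightarrow> division_abscissa b x"

locale flex_curve =
  fixes t :: complex
  assumes t_nonzero: "t \<noteq> 0" and t_nonminus4: "t \<noteq> - 4"

sublocale flex_curve \<subseteq> smooth_cubic 9 "- (6 * t)" "t^2"
proof
  fix x assume 0: "x^3 + 9 * x^2 + (- (6 * t)) * x + t^2 = 0"
  show "3 * x^2 + 2 * 9 * x + (- (6 * t)) \<noteq> 0"
  proof
    assume 1: "3 * x^2 + 2 * 9 * x + (- (6 * t)) = 0"
    then have t: "t = (x^2 + 6 * x) / 2" by algebra
    have "x^3 * (x + 4) = 0" using 0 unfolding t by (simp add: field_simps) algebra
    then have "x = 0 \<or> x = - 4" by (simp add: eq_neg_iff_add_eq_0)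
    then show False using t t_nonzero t_nonminus4 by auto
  qed
qed

context flex_curve
begin

abbreviation flex_add :: "point \<Rightarrow> point \<Rightarrow> point" (infixl "\<oplus>\<^sub>E" 65)
  where "P \<oplus>\<^sub>E Q \<equiv> ec_add E P Q"

lemma f_eq: "f x = flex_cubic t x"
  unfolding f_def flex_cubic_def by algebra

lemma flex_double_abscissa:
  assumes "y^2 = f x" "y \<noteq> 0"
  obtains y' where "Affine x y \<oplus>\<^sub>E Affine x y = Affine (flex_double t x) y'"
proof -
  have f0: "f x \<noteq> 0" using assms by auto
  then have "(3 * x^2 + 2 * 9 * x + (- (6 * t)))^2 / (4 * f x) - 9 - 2 * x =
      ((3 * x^2 + 2 * 9 * x + (- (6 * t)))^2 - (9 + 2 * x) * (4 * f x)) / (4 * f x)"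
    by (simp add: field_simps)
  also have "(3 * x^2 + 2 * 9 * x + (- (6 * t)))^2 - (9 + 2 * x) * (4 * f x) = x * (x^3 + 12 * t * x - 8 * t^2)"
    unfolding f_def by algebra
  finally show ?thesis using double_abscissa[OF assms] that unfolding flex_double_def f_eq by metis
qed

lemma torsion_of_division_abscissa:
  assumes "division_abscissa t x" "y^2 = f x"
  shows "Affine x y \<in> torsion E"
  using assms
proof (induction x arbitrary: y)
  case (two x)
  then show ?case using torsion_of_order_two[of x y] by (simp add: f_eq del: Affine_mem) (simp add: f_eq)
next
  case (three x)
  have P: "Affine x y \<in> curve" using three by simp
  show ?case
  proof (cases "y = 0")
    case True then show ?thesis using torsion_of_order_two P by blast
  next
    case False
    obtain y' where D: "Affine x y \<oplus>\<^sub>E Affine x y = Affine x y'"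
      using flex_double_abscissa[OF three(2) False] three by metis
    have "Affine x y' \<in> curve" using add_closed[OF P P] D by simp
    then have "y'^2 = y^2" using three by simp
    then consider "y' = y" | "y' = - y" by (auto simp: power2_eq_iff)
    then show ?thesis
    proof cases
      case 1
      then have "(Affine x y \<oplus>\<^sub>E Affine x y) \<oplus>\<^sub>E ec_neg (Affine x y) = Origin"
        using D add_neg(1) by (simp only:)
      then show ?thesis using add_assoc[OF P P neg_closed[OF P]] by (simp only: add_neg add_Origin Origin_torsion)
    next
      case 2
      have "Affine x y [^]\<^bsub>G\<^esub> (3::nat) = (Affine x y \<oplus>\<^sub>E Affine x y) \<oplus>\<^sub>E Affine x y"
        using P by (simp add: numeral_3_eq_3)
      also have "\<dots> = Origin" unfolding D 2 using add_neg(2)[of "Affine x y"] by simp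
      finally show ?thesis using P by (auto simp: torsion_iff intro!: exI[of _ 3])
    qed
  qed
next
  case (halve x)
  have P: "Affine x y \<in> curve" using halve by simp
  show ?case
  proof (cases "y = 0")
    case True then show ?thesis using torsion_of_order_two P by blast
  next
    case False
    obtain y' where D: "Affine x y \<oplus>\<^sub>E Affine x y = Affine (flex_double t x) y'"
      using flex_double_abscissa[OF halve(3) False] by metis
    have "Affine (flex_double t x) y' \<in> curve" using add_closed[OF P P] D by simp
    then have "Affine x y \<oplus>\<^sub>E Affine x y \<in> torsion E" using halve.IH D by simp
    then show ?thesis using torsion_half P by blast
  qed
qed

end

text \<open>With N = x^3 + 12 b x - 8 b^2 this exhibits the ordinate y N / (sqrt (- 27) x^3) of the
  image point. N vanishes where 2 P is a flex, that is, at sums of a flex and a point of order 2;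
  these go to points of order 2.\<close>

lemma flex_cubic_isogeny:
  assumes "x \<noteq> 0"
  shows "27 * x^6 * flex_cubic (- 4 - b) (flex_isogeny b x) = - flex_cubic b x * (x^3 + 12 * b * x - 8 * b^2)^2"
proof -
  define z where "z = flex_isogeny b x"
  have z: "3 * x^2 * z = - (x^3 + 12 * x^2 - 12 * b * x + 4 * b^2)" using assms by (simp add: z_def flex_isogeny_def)
  have "27 * x^6 * flex_cubic (- 4 - b) z = (3 * x^2 * z)^3 + 3 * x^2 * (3 * (3 * x^2 * z) + 3 * x^2 * (4 + b))^2"
    unfolding flex_cubic_def by algebra
  also have "\<dots> = - flex_cubic b x * (x^3 + 12 * b * x - 8 * b^2)^2"
    unfolding z flex_cubic_def by algebra
  finally show ?thesis unfolding z_def .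
qed

text \<open>An isogeny commutes with doubling. The hypotheses keep P and 2 P out of the kernel,
  where the abscissa map has its poles. Eliminating w through 4 T w = x N leaves a polynomial
  identity in x and b.\<close>

lemma flex_double_isogeny:
  assumes x: "x \<noteq> 0" and T: "flex_cubic b x \<noteq> 0" and N: "x^3 + 12 * b * x - 8 * b^2 \<noteq> 0"
  shows "flex_double (- 4 - b) (flex_isogeny b x) = flex_isogeny b (flex_double b x)"
proof -
  define N where "N = x^3 + 12 * b * x - 8 * b^2"
  define M where "M = x^3 + 12 * x^2 - 12 * b * x + 4 * b^2"
  define T where "T = flex_cubic b x"
  define z where "z = flex_isogeny b x"
  define w where "w = flex_double b x"
  have nz: "N \<noteq> 0" "T \<noteq> 0" using assms by (simp_all add: N_def T_def)
  have z: "3 * x^2 * z = - M" using x by (simp add: z_def flex_isogeny_def M_def)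
  have w: "4 * T * w = x * N" using nz by (simp add: w_def flex_double_def N_def T_def)
  have w0: "w \<noteq> 0" using w nz x by auto
  have Z: "27 * x^6 * flex_cubic (- 4 - b) z = - T * N^2"
    using flex_cubic_isogeny[OF x, of b] by (simp add: z_def T_def N_def)
  have F: "flex_cubic (- 4 - b) z \<noteq> 0" using Z nz by auto
  have "12 * x^2 * T * N^2 * flex_double (- 4 - b) z = - 4 * 81 * x^8 * flex_cubic (- 4 - b) z * flex_double (- 4 - b) z"
    using Z by algebra
  also have "\<dots> = - 81 * x^8 * (z * (z^3 + 12 * (- 4 - b) * z - 8 * (- 4 - b)^2))"
    using F by (simp add: flex_double_def)
  also have "\<dots> = - ((3 * x^2 * z) * ((3 * x^2 * z)^3 + 108 * (- 4 - b) * x^4 * (3 * x^2 * z) - 216 * (- 4 - b)^2 * x^6))"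
    by algebra
  also have "\<dots> = - (M * (M^3 + 108 * (- 4 - b) * x^4 * M + 216 * (- 4 - b)^2 * x^6))"
    unfolding z by algebra
  also have "\<dots> = - (x^3 * N^3 + 48 * x^2 * N^2 * T - 192 * b * x * N * T^2 + 256 * b^2 * T^3)"
    unfolding M_def N_def T_def flex_cubic_def by algebra
  also have "\<dots> = - ((x * N)^3 + 48 * T * (x * N)^2 - 192 * b * T^2 * (x * N) + 256 * b^2 * T^3)"
    by algebra
  also have "\<dots> = - 64 * T^3 * (w^3 + 12 * w^2 - 12 * b * w + 4 * b^2)"
    unfolding w[symmetric] by algebra
  also have "\<dots> = 64 * T^3 * 3 * w^2 * flex_isogeny b w" using w0 by (simp add: flex_isogeny_def field_simps)
  also have "\<dots> = 12 * T * (4 * T * w)^2 * flex_isogeny b w" by algebra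
  also have "\<dots> = 12 * x^2 * T * N^2 * flex_isogeny b w" unfolding w by algebra
  finally show ?thesis using nz x by (simp add: z_def w_def)
qed

lemma division_abscissa_isogeny:
  assumes "division_abscissa b x" "x \<noteq> 0" "b \<noteq> 0"
  shows "division_abscissa (- 4 - b) (flex_isogeny b x)"
  using assms
proof (induction x)
  case (two x)
  then have "flex_cubic (- 4 - b) (flex_isogeny b x) = 0" using flex_cubic_isogeny[of x b] by simp
  then show ?case by (rule division_abscissa.two)
next
  case (three x)
  show ?case
  proof (cases "flex_cubic (- 4 - b) (flex_isogeny b x) = 0")
    case False
    then have "flex_cubic b x \<noteq> 0" "x^3 + 12 * b * x - 8 * b^2 \<noteq> 0"
      using flex_cubic_isogeny[of x b] three by auto
    then show ?thesis using flex_double_isogeny[of x b] three by (intro division_abscissa.three) simp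
  qed (rule division_abscissa.two)
next
  case (halve x)
  show ?case
  proof (cases "flex_cubic (- 4 - b) (flex_isogeny b x) = 0")
    case False
    then have *: "flex_cubic b x \<noteq> 0" "x^3 + 12 * b * x - 8 * b^2 \<noteq> 0"
      using flex_cubic_isogeny[of x b] halve by auto
    then have "flex_double b x \<noteq> 0" using halve.prems by (simp add: flex_double_def)
    then show ?thesis
      using halve.IH[OF _ halve.prems(2)] division_abscissa.halve
      by (metis flex_double_isogeny[OF halve.prems(1) *])
  qed (rule division_abscissa.two)
qed

text \<open>The three roots p of p^3 - 3 p = s give collinear points (t / p^2, t k / p^3), where
  k^2 = s^2 + t; here s = p0 (p0^2 - 3). The difference of two of these points is the image under
  the isogeny of the point with abscissa (- 4 - t) / (4 - p0^2).\<close>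

lemma (in flex_curve) torsion_partner_aux:
  assumes p1: "p1^2 = 3 - p0 * p1 - p0^2" and p2: "p2 = - p0 - p1"
    and ne: "p0 \<noteq> 0" "p1 \<noteq> 0" "p2 \<noteq> 0" "p0^2 \<noteq> 4"
    and P0: "division_abscissa t (t / p0^2)"
    and Q0: "division_abscissa (- 4 - t) ((- 4 - t) / (4 - p0^2))"
    and y: "y^2 = f (t / p1^2)"
  shows "Affine (t / p1^2) y \<in> torsion E"
proof -
  define q where "q = p0^2 - 3"
  have q: "p1 * p2 = q" using p1 p2 unfolding q_def by algebra
  have q0: "q \<noteq> 0" using q ne by auto
  have sum: "p1 + p2 = - p0" using p2 by simp
  define s where "s = p0 * q"
  have s0: "s \<noteq> 0" using q0 ne by (simp add: s_def)
  define k where "k = csqrt (t + s^2)"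
  have k: "k^2 = t + s^2" by (simp add: k_def)
  have root: "p * (p^2 - 3) = s" if "p \<in> {p0, p1, p2}" for p
    using that p1 p2 unfolding s_def q_def by auto algebra+
  have on: "(t * k / p^3)^2 = f (t / p^2)" if "p \<in> {p0, p1, p2}" for p
  proof -
    have p: "p \<noteq> 0" using that ne by auto
    have "f (t / p^2) = (t^3 + t^2 * (p * (3 - p^2))^2) / p^6"
      unfolding f_eq flex_cubic_def using p by (simp add: field_simps) algebra
    also have "p * (3 - p^2) = - s" unfolding root[OF that, symmetric] by algebra
    also have "t^3 + t^2 * (- s)^2 = t^2 * k^2" unfolding k by algebra
    finally show ?thesis by (simp add: power_divide power_mult_distrib flip: power_mult)
  qed
  \<comment> \<open>The difference p2 - p1 enters the abscissa of P1 - P2 only through this square.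
    That abscissa is therefore a rational function of p0^2 and t and can be compared with the
    isogeny.\<close>
  have diff: "(p2 - p1)^2 = 3 * (4 - p0^2)" using p1 p2 by algebra
  have d0: "p2 - p1 \<noteq> 0" using diff ne by auto
  have neq: "t / p1^2 \<noteq> t / p2^2"
  proof
    assume "t / p1^2 = t / p2^2"
    then have "(p2 - p1) * (p2 + p1) = 0" using ne t_nonzero by (simp add: field_simps power2_eq_square)
    then show False using d0 sum ne by (simp add: add.commute)
  qed
  define P1 where "P1 = Affine (t / p1^2) (t * k / p1^3)"
  define P2 where "P2 = Affine (t / p2^2) (t * k / p2^3)"
  have P: "P1 \<in> curve" "P2 \<in> curve" using on by (auto simp: P1_def P2_def)
  \<comment> \<open>The equation p^3 - 3 p = s, multiplied by t k / (s p^3), says that the point for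
    p lies on the line y = l x + t k / s. The chord through P1 and - P2 has slope l'.\<close>
  define l where "l = - 3 * k / s"
  define l' where "l' = k * (9 - 2 * p0^2) / (q * (p2 - p1))"
  have ch: "t * k / p^3 = l * (t / p^2) + t * k / s" if "p \<in> {p0, p1, p2}" for p
  proof -
    have p: "p \<noteq> 0" and p3: "p^2 - 3 \<noteq> 0" using root[OF that] s0 ne that by auto
    have "l * (t / p^2) + t * k / s = t * k * (p^2 - 3) / (s * p^2)"
      unfolding l_def using p s0 by (simp add: field_simps)
    also have "\<dots> = t * k / p^3"
      unfolding root[OF that, symmetric] using p p3 by (simp add: power2_eq_square power3_eq_cube)
    finally show ?thesis by simp
  qed
  have Pp: "P1 \<oplus>\<^sub>E P2 = Affine (t / p0^2) (- (t * k / p1^3 + l * (t / p0^2 - t / p1^2)))"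
    unfolding P1_def P2_def
  proof (rule add_chord[OF neq])
    show "t * k / p2^3 - t * k / p1^3 = l * (t / p2^2 - t / p1^2)"
      using ch[of p1] ch[of p2] by (simp add: algebra_simps)
    have "l^2 = 9 * k^2 / s^2" by (simp add: l_def power_divide power_mult_distrib)
    also have "\<dots> = 9 * t / s^2 + 9" unfolding k using s0 by (simp add: field_simps)
    also have "9 * t / s^2 = t * (1 / p0^2 + 1 / p1^2 + 1 / p2^2)"
    proof -
      have s': "s = p0 * p1 * p2" using q s_def by simp
      have "p0^2 * p1^2 + p0^2 * p2^2 + p1^2 * p2^2 = 9" using p1 p2 by algebra
      then show ?thesis unfolding s' using ne by (simp add: field_simps)
    qed
    finally show "t / p0^2 = l^2 - 9 - t / p1^2 - t / p2^2" by (simp add: algebra_simps add_divide_distrib)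
  qed
  have "P1 \<oplus>\<^sub>E P2 \<in> torsion E"
    using add_closed[OF P] unfolding Pp by (intro torsion_of_division_abscissa[OF P0]) simp
  moreover
  have "(- 4 - t) / (4 - p0^2) \<noteq> 0" using t_nonminus4 ne by auto
  then have R: "division_abscissa t (flex_isogeny (- 4 - t) ((- 4 - t) / (4 - p0^2)))"
    using division_abscissa_isogeny[OF Q0] t_nonminus4 by auto
  have "P1 \<oplus>\<^sub>E ec_neg P2 = Affine (flex_isogeny (- 4 - t) ((- 4 - t) / (4 - p0^2)))
      (- (t * k / p1^3 + l' * (flex_isogeny (- 4 - t) ((- 4 - t) / (4 - p0^2)) - t / p1^2)))"
    unfolding P1_def P2_def ec_neg.simps
  proof (rule add_chord[OF neq])
    have "p1^3 + p2^3 = - p0 * (9 - 2 * p0^2)" using p1 p2 by algebra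
    then have e: "(p1^3 + p2^3) = (p1 + p2) * (9 - 2 * p0^2)" using sum by simp
    have "- (t * k / p2^3) - t * k / p1^3 = - t * k * (p1^3 + p2^3) / (p1 * p2)^3"
      using ne by (simp add: field_simps)
    also have "\<dots> = l' * (t * (p1^2 - p2^2) / (p1 * p2)^2)"
      unfolding e q l'_def using q0 d0 by (simp add: field_simps) algebra
    also have "t * (p1^2 - p2^2) / (p1 * p2)^2 = t / p2^2 - t / p1^2"
      using ne by (simp add: field_simps)
    finally show "- (t * k / p2^3) - t * k / p1^3 = l' * (t / p2^2 - t / p1^2)" .
    have l2: "l'^2 = (t + p0^2 * q^2) * (9 - 2 * p0^2)^2 / (q^2 * (3 * (4 - p0^2)))"
      by (simp add: l'_def power_divide power_mult_distrib k diff s_def)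
    have sq: "p1^2 + p2^2 = p0^2 - 2 * q" using sum q by algebra
    have "t / p1^2 + t / p2^2 = t * (p1^2 + p2^2) / (p1 * p2)^2"
      using ne by (simp add: field_simps)
    then have "t / p1^2 + t / p2^2 = t * (p0^2 - 2 * q) / q^2" unfolding q sq .
    moreover have "flex_isogeny (- 4 - t) ((- 4 - t) / (4 - p0^2)) = l'^2 - 9 - t * (p0^2 - 2 * q) / q^2"
    proof -
      define d where "d = 4 - p0^2"
      define b' where "b' = - 4 - t"
      have d: "d \<noteq> 0" "p0^2 = 4 - d" "q = 1 - d" using ne by (auto simp: d_def q_def)
      have b': "b' \<noteq> 0" "t = - 4 - b'" using t_nonminus4 by (auto simp: b'_def)
      have "3 * q^2 * d * (flex_isogeny b' (b' / d)) = - (q^2 * (b' + 12 * d - 12 * d^2 + 4 * d^3))"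
        unfolding flex_isogeny_def using d(1) b'(1) by (simp add: field_simps eval_nat_numeral)
      also have "\<dots> = (t + (4 - d) * q^2) * (9 - 2 * (4 - d))^2 - 27 * q^2 * d - 3 * d * t * (4 - d - 2 * q)"
        unfolding d(3) b'(2) by algebra
      also have "\<dots> = 3 * q^2 * d * ((t + p0^2 * q^2) * (9 - 2 * p0^2)^2 / (q^2 * (3 * d)) - 9 - t * (p0^2 - 2 * q) / q^2)"
        unfolding d(2) using d(1) q0 by (simp add: field_simps)
      finally show ?thesis unfolding l2 d_def[symmetric] b'_def[symmetric] using d q0 by simp
    qed
    ultimately show "flex_isogeny (- 4 - t) ((- 4 - t) / (4 - p0^2)) = l'^2 - 9 - t / p1^2 - t / p2^2"
      by (simp add: algebra_simps)
  qed
  then have "P1 \<oplus>\<^sub>E ec_neg P2 \<in> torsion E"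
    using torsion_of_division_abscissa[OF R] add_closed[OF P(1) neg_closed[OF P(2)]] by (metis Affine_mem)
  ultimately have "(P1 \<oplus>\<^sub>E P2) \<oplus>\<^sub>E (P1 \<oplus>\<^sub>E ec_neg P2) \<in> torsion E" by (rule torsion_add)
  also have "(P1 \<oplus>\<^sub>E P2) \<oplus>\<^sub>E (P1 \<oplus>\<^sub>E ec_neg P2) = P1 \<oplus>\<^sub>E P1"
  proof -
    have "P2 \<oplus>\<^sub>E (P1 \<oplus>\<^sub>E ec_neg P2) = (P2 \<oplus>\<^sub>E ec_neg P2) \<oplus>\<^sub>E P1"
      using P neg_closed add_assoc add_comm add_closed by metis
    then show ?thesis using add_assoc[OF P add_closed[OF P(1) neg_closed[OF P(2)]]] by (simp add: add_neg)
  qed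
  finally have T: "P1 \<in> torsion E" using torsion_half P by blast
  have "y^2 = (t * k / p1^3)^2" using y on by simp
  then have "y = t * k / p1^3 \<or> y = - (t * k / p1^3)" by (simp only: power2_eq_iff)
  then show ?thesis using T torsion_neg[OF T] by (auto simp: P1_def)
qed

text \<open>The substitution u = p^2 - 2 carries the relation between p0 and p1 to the same relation
  between u0 and u1. Conversely, u0 determines p0 only up to sign; for given p1 one of the two signs
  fits.\<close>

lemma (in flex_curve) torsion_partner:
  assumes u: "u1^2 = 3 - u0 * u1 - u0^2" and ne: "u0 \<noteq> 2" "u0 \<noteq> - 2" "u1 \<noteq> - 2" "u0 + u1 \<noteq> 2"
    and P0: "division_abscissa t (t / (u0 + 2))"
    and Q0: "division_abscissa (- 4 - t) ((- 4 - t) / (2 - u0))"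
    and y: "y^2 = f (t / (u1 + 2))"
  shows "Affine (t / (u1 + 2)) y \<in> torsion E"
proof -
  define p1 where "p1 = csqrt (u1 + 2)"
  define r where "r = csqrt (u0 + 2)"
  have p1: "p1^2 = u1 + 2" and r: "r^2 = u0 + 2" by (simp_all add: p1_def r_def)
  have "(p1^2 + r * p1 + r^2 - 3) * (p1^2 + (- r) * p1 + r^2 - 3) = 0" using p1 r u by algebra
  then obtain p0 where p0: "p0^2 = u0 + 2" and e: "p1^2 = 3 - p0 * p1 - p0^2"
  proof -
    from \<open>_ = 0\<close> consider "p1^2 + r * p1 + r^2 - 3 = 0" | "p1^2 + (- r) * p1 + r^2 - 3 = 0" by fastforce
    then show ?thesis
    proof cases
      case 1
      then have "p1^2 = 3 - r * p1 - r^2" by algebra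
      then show ?thesis using that[of r] r by simp
    next
      case 2
      then have "p1^2 = 3 - (- r) * p1 - (- r)^2" by algebra
      then show ?thesis using that[of "- r"] r by simp
    qed
  qed
  have "(- p0 - p1)^2 = 2 - u0 - u1" using e p0 p1 by algebra
  moreover have "2 - u0 - u1 \<noteq> 0" using ne(4) by (metis diff_diff_add eq_iff_diff_eq_0)
  ultimately have 2: "- p0 - p1 \<noteq> 0" by auto
  have 0: "p0 \<noteq> 0" "p1 \<noteq> 0" "p0^2 \<noteq> 4" using p0 p1 ne by (auto simp: add_eq_0_iff2)
  have "4 - p0^2 = 2 - u0" using p0 by simp
  then show ?thesis using torsion_partner_aux[OF e refl 0(1,2) 2 0(3)] p0 p1 P0 Q0 y by simp
qed

section \<open>Double covers\<close>

lemma hpt_scale: "k \<noteq> 0 \<Longrightarrow> hpt (k * u) (k * v) = hpt u v"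
  by (simp add: hpt_def)

lemma (in smooth_cubic) elliptic_curve_E: "elliptic_curve E"
  unfolding elliptic_curve_def
proof (intro allI impI notI)
  fix x y assume "on_affine E x y"
    and "a1 E * y - (3 * x^2 + 2 * a2 E * x + a4 E) = 0 \<and> 2 * y + a1 E * x + a3 E = 0"
  then have "x^3 + a * x^2 + b * x + c = 0" "- (3 * x^2 + 2 * a * x + b) = 0"
    by (auto simp: on_affine_def E_def)
  then show False using smooth[of x] by (metis neg_equal_0_iff_equal)
qed

text \<open>The points with abscissa e + r s or e - r s are the halves of (e, 0). The function cover_x
  is chosen so that its branch points are \<alpha>, - \<alpha>, 1 / \<alpha> and - 1 / \<alpha>.\<close>

locale marked_cubic = smooth_cubic +
  fixes e r s \<alpha> :: complex
  assumes factors: "\<And>x. x^3 + a * x^2 + b * x + c = (x - e) * (x - e - r^2) * (x - e - s^2)"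
    and r_nonzero: "r \<noteq> 0" and s_nonzero: "s \<noteq> 0" and rs: "r^2 \<noteq> s^2"
    and alpha_sq: "\<alpha>^2 = (s - r) / (s + r)"
begin

definition cover_x :: "complex \<Rightarrow> p1" where
  "cover_x x = hpt (\<alpha> * (x - e + r * s)) (x - e - r * s)"

fun cover :: "point \<Rightarrow> p1" where
  "cover Origin = Fin \<alpha>"
| "cover (Affine x y) = cover_x x"

lemma f_factors: "f x = (x - e) * (x - e - r^2) * (x - e - s^2)"
  unfolding f_def by (rule factors)

lemma f_eq_0_iff: "f x = 0 \<longleftrightarrow> x = e \<or> x = e + r^2 \<or> x = e + s^2"
  unfolding f_factors by (auto simp: diff_diff_eq)

lemma coeffs: "a = - (3 * e + r^2 + s^2)" "b = 3 * e^2 + 2 * e * (r^2 + s^2) + r^2 * s^2"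
proof -
  have 0: "c = (0 - e) * (0 - e - r^2) * (0 - e - s^2)" using factors[of 0] by simp
  have 1: "1 + a + b + c = (1 - e) * (1 - e - r^2) * (1 - e - s^2)" using factors[of 1] by simp
  have 2: "a - 1 - b + c = (- 1 - e) * (- 1 - e - r^2) * (- 1 - e - s^2)" using factors[of "- 1"] by simp
  have "2 * a = (1 + a + b + c) + (a - 1 - b + c) - 2 * c" by simp
  also have "\<dots> = 2 * (- (3 * e + r^2 + s^2))" unfolding 1 2 unfolding 0 by algebra
  finally show "a = - (3 * e + r^2 + s^2)" by (metis mult_left_cancel zero_neq_numeral)
  have "2 * b = (1 + a + b + c) - (a - 1 - b + c) - 2" by simp
  also have "\<dots> = 2 * (3 * e^2 + 2 * e * (r^2 + s^2) + r^2 * s^2)" unfolding 1 2 by algebra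
  finally show "b = 3 * e^2 + 2 * e * (r^2 + s^2) + r^2 * s^2" by (metis mult_left_cancel zero_neq_numeral)
qed

lemma r_plus_s: "r + s \<noteq> 0" "s - r \<noteq> 0"
  using rs by (auto simp: add_eq_0_iff2)

lemma alpha_nonzero: "\<alpha> \<noteq> 0"
  using alpha_sq r_plus_s by (auto simp: add.commute)

lemma alpha_sq': "\<alpha>^2 * (s + r) = s - r"
  using alpha_sq r_plus_s by (simp add: add.commute)

lemma cover_x_eq_Fin: "cover_x x = Fin v \<longleftrightarrow> x - e \<noteq> r * s \<and> \<alpha> * (x - e + r * s) = v * (x - e - r * s)"
  by (auto simp: cover_x_def hpt_def field_simps)

lemma cover_x_eq_Infty: "cover_x x = Infty \<longleftrightarrow> x - e = r * s"
  by (auto simp: cover_x_def hpt_def)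

lemma cover_x_ne: "cover_x x \<noteq> Fin \<alpha>"
proof
  assume "cover_x x = Fin \<alpha>"
  then have "\<alpha> * (2 * r * s) = 0" unfolding cover_x_eq_Fin by algebra
  then show False using alpha_nonzero r_nonzero s_nonzero by simp
qed

lemma cover_x_inj: "cover_x x = cover_x x' \<longleftrightarrow> x = x'"
proof
  assume eq: "cover_x x = cover_x x'"
  show "x = x'"
  proof (cases "cover_x x")
    case Infty
    then have "x - e = x' - e" using eq cover_x_eq_Infty by metis
    then show ?thesis by simp
  next
    case (Fin v)
    then have 1: "\<alpha> * (x - e + r * s) = v * (x - e - r * s)" "\<alpha> * (x' - e + r * s) = v * (x' - e - r * s)"
      using eq cover_x_eq_Fin by metis+
    have "v \<noteq> \<alpha>" using Fin cover_x_ne by auto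
    moreover have "(\<alpha> - v) * (x - x') = 0" using 1 by algebra
    ultimately show ?thesis by simp
  qed
qed simp

lemma cover_x_surj:
  assumes "v \<noteq> \<alpha>"
  shows "cover_x (e + r * s * (v + \<alpha>) / (v - \<alpha>)) = Fin v"
proof -
  define z where "z = r * s * (v + \<alpha>) / (v - \<alpha>)"
  have v: "v - \<alpha> \<noteq> 0" using assms by simp
  have z: "(v - \<alpha>) * z = r * s * (v + \<alpha>)" using v by (simp add: z_def)
  have "z \<noteq> r * s"
  proof
    assume "z = r * s"
    then have "2 * (r * s) * \<alpha> = 0" using z by algebra
    then show False using r_nonzero s_nonzero alpha_nonzero by simp
  qed
  moreover have "\<alpha> * (z + r * s) = v * (z - r * s)" using z by algebra
  ultimately show ?thesis unfolding cover_x_eq_Fin z_def[symmetric] by simp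
qed

lemma cover_x_surj':
  assumes "w \<noteq> Fin \<alpha>" obtains x where "cover_x x = w"
proof (cases w)
  case (Fin v)
  then show ?thesis using cover_x_surj[of v] that assms by auto
next
  case Infty
  then show ?thesis using cover_x_eq_Infty[of "e + r * s"] that by auto
qed

lemma morphism_cover: "morphism E cover"
  unfolding morphism_def
proof
  fix P assume "P \<in> points E"
  show "\<exists>d g h. (form d g P \<noteq> 0 \<or> form d h P \<noteq> 0) \<and>
    (\<forall>Q\<in>points E. form d g Q \<noteq> 0 \<or> form d h Q \<noteq> 0 \<longrightarrow> cover Q = hpt (form d g Q) (form d h Q))"
  proof (cases P)
    case (Affine x0 y0)
    define g :: "nat \<Rightarrow> nat \<Rightarrow> complex" where "g = (\<lambda>i j. if j = 1 then 0 else if i = 1 then \<alpha> else \<alpha> * (r * s - e))"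
    define h :: "nat \<Rightarrow> nat \<Rightarrow> complex" where "h = (\<lambda>i j. if j = 1 then 0 else if i = 1 then 1 else - (r * s + e))"
    have form: "form 1 g (Affine x y) = \<alpha> * (x - e + r * s)" "form 1 h (Affine x y) = x - e - r * s"
      "form 1 g Origin = 0" "form 1 h Origin = 0" for x y
      by (simp_all add: form_def g_def h_def algebra_simps)
    have "form 1 g P \<noteq> 0 \<or> form 1 h P \<noteq> 0"
      using Affine form alpha_nonzero r_nonzero s_nonzero by (auto simp: add_eq_0_iff2)
    moreover have "\<forall>Q\<in>points E. form 1 g Q \<noteq> 0 \<or> form 1 h Q \<noteq> 0 \<longrightarrow> cover Q = hpt (form 1 g Q) (form 1 h Q)"
    proof (intro ballI impI)
      fix Q assume "form 1 g Q \<noteq> 0 \<or> form 1 h Q \<noteq> 0"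
      then show "cover Q = hpt (form 1 g Q) (form 1 h Q)"
        using form by (cases Q) (simp_all add: cover_x_def)
    qed
    ultimately show ?thesis by blast
  next
    case Origin
    \<comment> \<open>Both linear forms vanish at \<open>Origin\<close>. After multiplication by x^2
      and replacement of x^3 by y^2 z - a x^2 z - b x z^2 - c z^3 they are divisible by z. The
      quotients are g and h, with the values \<alpha> and 1 at \<open>Origin\<close>.\<close>
    define F :: "nat \<Rightarrow> nat \<Rightarrow> complex" where
      "F = (\<lambda>i j. if i = 0 \<and> j = 2 then 1 else if i = 2 \<and> j = 0 then - a else if i = 1 \<and> j = 0 then - b
        else if i = 0 \<and> j = 0 then - c else 0)"
    define X2 :: "nat \<Rightarrow> nat \<Rightarrow> complex" where "X2 = (\<lambda>i j. if i = 2 \<and> j = 0 then 1 else 0)"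
    define g where "g = (\<lambda>i j. \<alpha> * F i j + \<alpha> * (r * s - e) * X2 i j)"
    define h where "h = (\<lambda>i j. F i j - (r * s + e) * X2 i j)"
    have form: "form 2 g (Affine x y) = x^2 * (\<alpha> * (x - e + r * s))" "form 2 h (Affine x y) = x^2 * (x - e - r * s)"
      if "y^2 = x^3 + a * x^2 + b * x + c" for x y
    proof -
      have "form 2 g (Affine x y) = \<alpha> * (y^2 - a * x^2 - b * x - c) + \<alpha> * (r * s - e) * x^2"
        "form 2 h (Affine x y) = (y^2 - a * x^2 - b * x - c) - (r * s + e) * x^2"
        by (simp_all add: form_def g_def h_def F_def X2_def numeral_2_eq_2 algebra_simps)
      then show "form 2 g (Affine x y) = x^2 * (\<alpha> * (x - e + r * s))" "form 2 h (Affine x y) = x^2 * (x - e - r * s)"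
        unfolding that by algebra+
    qed
    have formO: "form 2 g Origin = \<alpha>" "form 2 h Origin = 1"
      by (simp_all add: form_def g_def h_def F_def X2_def numeral_2_eq_2)
    have "\<forall>Q\<in>points E. form 2 g Q \<noteq> 0 \<or> form 2 h Q \<noteq> 0 \<longrightarrow> cover Q = hpt (form 2 g Q) (form 2 h Q)"
    proof (intro ballI impI)
      fix Q assume Q: "Q \<in> points E" and nz: "form 2 g Q \<noteq> 0 \<or> form 2 h Q \<noteq> 0"
      show "cover Q = hpt (form 2 g Q) (form 2 h Q)"
      proof (cases Q)
        case Origin
        then show ?thesis using formO by (simp add: hpt_def)
      next
        case (Affine x y)
        then have "y^2 = x^3 + a * x^2 + b * x + c" using Q f_def by simp
        note frm = form[OF this]
        have "x^2 \<noteq> 0" using nz frm Affine by auto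
        then show ?thesis unfolding Affine frm by (simp add: hpt_scale cover_x_def)
      qed
    qed
    then show ?thesis using formO Origin by (intro exI[of _ 2] exI[of _ g] exI[of _ h]) simp
  qed
qed

lemma ramified_Origin: "ramified_at E cover Origin"
proof -
  have "P = Origin" if "cover P = Fin \<alpha>" for P using that cover_x_ne by (cases P) auto
  then show ?thesis by (auto simp: ramified_at_def fibre_def)
qed

lemma double_cover: "double_cover E cover"
proof -
  have "{w. card (fibre E cover w) \<noteq> 2} \<subseteq> insert (Fin \<alpha>) (cover_x ` {e, e + r^2, e + s^2})"
  proof (rule subsetI, rule ccontr)
    fix w assume w: "w \<in> {w. card (fibre E cover w) \<noteq> 2}" and n: "w \<notin> insert (Fin \<alpha>) (cover_x ` {e, e + r^2, e + s^2})"
    obtain x where x: "cover_x x = w" using cover_x_surj'[of w] n by auto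
    have "f x \<noteq> 0" using n x by (auto simp: f_eq_0_iff)
    define y where "y = csqrt (f x)"
    have y: "y^2 = f x" "y \<noteq> 0" using \<open>f x \<noteq> 0\<close> by (auto simp: y_def)
    have "fibre E cover w = {Affine x y, Affine x (- y)}"
    proof
      show "{Affine x y, Affine x (- y)} \<subseteq> fibre E cover w" using x y by (auto simp: fibre_def)
      show "fibre E cover w \<subseteq> {Affine x y, Affine x (- y)}"
      proof
        fix P assume P: "P \<in> fibre E cover w"
        show "P \<in> {Affine x y, Affine x (- y)}"
        proof (cases P)
          case Origin then show ?thesis using P n by (auto simp: fibre_def)
        next
          case (Affine x' y')
          then have "x' = x" using P x by (simp add: fibre_def flip: cover_x_inj)
          moreover then have "y'^2 = y^2" using P y Affine by (simp add: fibre_def)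
          ultimately show ?thesis using Affine by (auto simp: power2_eq_iff)
        qed
      qed
    qed
    moreover have "y \<noteq> - y" using y by simp
    ultimately show False using w by simp
  qed
  then have "finite {w. card (fibre E cover w) \<noteq> 2}" by (rule finite_subset) simp
  then show ?thesis using morphism_cover by (simp add: double_cover_def)
qed

lemma n_torsion_2: "n_torsion E 2 = {Origin, Affine e 0, Affine (e + r^2) 0, Affine (e + s^2) 0}"
proof -
  have m: "ec_mult E 2 P = P \<oplus>\<^sub>E P" for P by (simp add: ec_mult_def numeral_2_eq_2)
  have "P \<in> n_torsion E 2 \<longleftrightarrow> P \<in> {Origin, Affine e 0, Affine (e + r^2) 0, Affine (e + s^2) 0}" for P
  proof (cases P)
    case (Affine x y)
    have "P \<oplus>\<^sub>E P = Origin \<longleftrightarrow> y = 0" unfolding Affine add_same_x by (simp add: Let_def)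
    then show ?thesis using Affine f_eq_0_iff[of x] by (auto simp: n_torsion_def m)
  qed (simp add: n_torsion_def m)
  then show ?thesis by blast
qed

lemma cover_n_torsion_2: "cover ` n_torsion E 2 = Fin ` {\<alpha>, - \<alpha>, 1 / \<alpha>, - 1 / \<alpha>}"
proof -
  have "cover_x e = Fin (- \<alpha>)" using r_nonzero s_nonzero by (simp add: cover_x_eq_Fin)
  moreover have "cover_x (e + r^2) = Fin (- 1 / \<alpha>)" "cover_x (e + s^2) = Fin (1 / \<alpha>)"
    unfolding cover_x_eq_Fin using alpha_nonzero r_nonzero s_nonzero r_plus_s alpha_sq'
    by (auto simp: power2_eq_square field_simps) algebra+
  ultimately show ?thesis unfolding n_torsion_2 by auto
qed

text \<open>Translations by the points of order 2 act on the value v of \<open>cover\<close> as v ->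
  - v, 1 / v and - 1 / v, so v^2 + 1 / v^2 depends on the doubled point alone. This is that function
  of its abscissa, with a pole at e and the values - 2 at e + r^2 and 2 at e + s^2.\<close>

definition doubled_cover_x :: "complex \<Rightarrow> complex" where
  "doubled_cover_x x = (4 * r^2 * s^2 / (x - e) - 2 * (r^2 + s^2)) / (r^2 - s^2)"

text \<open>Hypothesis \<open>d\<close> is the duplication formula relative to e: for nonzero y, X -
  e is the square of ((x - e)^2 - r^2 s^2) / (2 y).\<close>

lemma torsion_of_double:
  assumes y: "y^2 = f x" and X: "\<And>y'. y'^2 = f X \<Longrightarrow> Affine X y' \<in> torsion E"
    and d: "4 * f x * (X - e) = ((x - e)^2 - r^2 * s^2)^2"
  shows "Affine x y \<in> torsion E"
proof (cases "y = 0")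
  case True
  then show ?thesis using torsion_of_order_two y by simp
next
  case False
  obtain y' where D: "Affine x y \<oplus>\<^sub>E Affine x y = Affine ((3 * x^2 + 2 * a * x + b)^2 / (4 * f x) - a - 2 * x) y'"
    using double_abscissa[OF y False] by metis
  have f0: "f x \<noteq> 0" using y False by auto
  have "4 * f x * ((3 * x^2 + 2 * a * x + b)^2 / (4 * f x) - a - 2 * x - e) =
     (3 * x^2 + 2 * a * x + b)^2 - 4 * f x * (a + 2 * x + e)"
    using f0 by (simp add: field_simps)
  also have "\<dots> = ((x - e)^2 - r^2 * s^2)^2" unfolding f_factors unfolding coeffs by algebra
  also have "\<dots> = 4 * f x * (X - e)" using d by simp
  finally have "(3 * x^2 + 2 * a * x + b)^2 / (4 * f x) - a - 2 * x - e = X - e"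
    using f0 by (metis mult_left_cancel mult_eq_0_iff zero_neq_numeral)
  then have "(3 * x^2 + 2 * a * x + b)^2 / (4 * f x) - a - 2 * x = X" by (metis diff_add_cancel)
  then have D: "Affine x y \<oplus>\<^sub>E Affine x y = Affine X y'" using D by simp
  have P: "Affine x y \<in> curve" using y by simp
  have "Affine X y' \<in> curve" using add_closed[OF P P] D by simp
  then have "Affine x y \<oplus>\<^sub>E Affine x y \<in> torsion E" using X D by simp
  then show ?thesis using torsion_half P by blast
qed

text \<open>Every v is the value of \<open>cover\<close> at some point. Solving for the abscissa x
  of that point shows that its double has abscissa X, unless the point has order at most 2 and is
  torsion anyway.\<close>

lemma Fin_in_cover_torsion:
  assumes X: "\<And>y. y^2 = f X \<Longrightarrow> Affine X y \<in> torsion E" and "X \<noteq> e"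
    and v: "v \<noteq> 0" "v^2 + 1 / v^2 = doubled_cover_x X"
  shows "Fin v \<in> cover ` torsion E"
proof (cases "v = \<alpha>")
  case True
  then show ?thesis by (metis Origin_torsion cover.simps(1) imageI)
next
  case False
  define z where "z = r * s * (v + \<alpha>) / (v - \<alpha>)"
  define x where "x = e + z"
  have c: "cover_x x = Fin v" using cover_x_surj[OF False] by (simp add: x_def z_def)
  have zv: "\<alpha> * (z + r * s) = v * (z - r * s)" "z - r * s \<noteq> 0" using c unfolding cover_x_eq_Fin x_def by auto
  have zp: "z + r * s \<noteq> 0" using zv v by auto
  have X0: "X - e \<noteq> 0" using \<open>X \<noteq> e\<close> by simp
  have R: "r^2 - s^2 \<noteq> 0" using rs by simp
  have 1: "4 * (r * s)^2 = (X - e) * ((r^2 - s^2) * (v^2 + 1 / v^2) + 2 * (r^2 + s^2))"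
  proof -
    have "(r^2 - s^2) * (v^2 + 1 / v^2) + 2 * (r^2 + s^2) = 4 * r^2 * s^2 / (X - e)"
      unfolding v(2) doubled_cover_x_def using R by simp
    then show ?thesis using X0 by (simp add: power_mult_distrib)
  qed
  have 2: "(r^2 - s^2) * v^2 * (z - r * s)^2 = - ((s - r)^2 * (z + r * s)^2)"
  proof -
    have "(r^2 - s^2) * v^2 * (z - r * s)^2 = - (s - r) * (s + r) * (v * (z - r * s))^2" by algebra
    also have "\<dots> = - (s - r) * (\<alpha>^2 * (s + r)) * (z + r * s)^2" unfolding zv(1)[symmetric] by algebra
    finally show ?thesis unfolding alpha_sq' by algebra
  qed
  have 3: "(r^2 - s^2) * (1 / v^2) * (z + r * s)^2 = - ((s + r)^2 * (z - r * s)^2)"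
  proof -
    have "\<alpha>^2 * ((r^2 - s^2) * (1 / v^2) * (z + r * s)^2) = (r^2 - s^2) * (1 / v^2) * (v * (z - r * s))^2"
      unfolding zv(1)[symmetric] by algebra
    also have "\<dots> = - (s + r) * (s - r) * (z - r * s)^2" using v(1) by (simp add: field_simps) algebra
    also have "\<dots> = \<alpha>^2 * (- ((s + r)^2 * (z - r * s)^2))" unfolding alpha_sq'[symmetric] by algebra
    finally show ?thesis using alpha_nonzero by (metis mult_left_cancel power_not_zero)
  qed
  define A where "A = (r^2 - s^2) * v^2"
  define B where "B = (r^2 - s^2) * (1 / v^2)"
  have "4 * (r * s)^2 * (z^2 - (r * s)^2)^2
     = (X - e) * ((A * (z - r * s)^2) * (z + r * s)^2 + (B * (z + r * s)^2) * (z - r * s)^2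
        + 2 * (r^2 + s^2) * (z^2 - (r * s)^2)^2)"
    unfolding 1 A_def B_def by algebra
  also have "\<dots> = (X - e) * (16 * (r * s)^2 * (z * (z - r^2) * (z - s^2)))"
    unfolding A_def B_def 2 3 by algebra
  also have "z * (z - r^2) * (z - s^2) = f x" by (simp add: f_factors x_def)
  finally have "4 * (r * s)^2 * (4 * f x * (X - e)) = 4 * (r * s)^2 * (z^2 - (r * s)^2)^2" by algebra
  then have d: "4 * f x * (X - e) = ((x - e)^2 - r^2 * s^2)^2"
    using r_nonzero s_nonzero by (simp add: x_def power_mult_distrib mult_ac)
  have "Affine x (csqrt (f x)) \<in> torsion E" by (rule torsion_of_double[OF _ X d]) auto
  then show ?thesis using c by (metis cover.simps(2) imageI)
qed

text \<open>These are the values over the pole e of \<open>doubled_cover_x\<close>: the halves of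
  (e, 0) have the abscissae e - r s and e + r s.\<close>

lemma Fin_0_in_cover_torsion: "Fin 0 \<in> cover ` torsion E"
  and Infty_in_cover_torsion: "Infty \<in> cover ` torsion E"
proof -
  have X: "Affine e y \<in> torsion E" if "y^2 = f e" for y
    using that torsion_of_order_two by (simp add: f_factors)
  have "Affine (e + r * s) (csqrt (f (e + r * s))) \<in> torsion E"
    "Affine (e - r * s) (csqrt (f (e - r * s))) \<in> torsion E"
    by (rule torsion_of_double[OF _ X]; simp add: power_mult_distrib)+
  moreover have "cover_x (e - r * s) = Fin 0" "cover_x (e + r * s) = Infty"
    using r_nonzero s_nonzero by (simp_all add: cover_x_eq_Fin cover_x_eq_Infty)
  ultimately show "Fin 0 \<in> cover ` torsion E" "Infty \<in> cover ` torsion E"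
    by (metis cover.simps(2) imageI)+
qed

end

section \<open>The invariant of four points\<close>

definition bracket_ab_cd :: "complex \<Rightarrow> complex \<Rightarrow> complex \<Rightarrow> complex \<Rightarrow> complex" where
  "bracket_ab_cd u v w z = (u - v) * (w - z)"

text \<open>The three products entering here are permuted up to sign by permutations of the four points,
  and their ratios are cross ratios.\<close>

definition quadruple_invariant :: "complex \<Rightarrow> complex \<Rightarrow> complex \<Rightarrow> complex \<Rightarrow> complex" where
  "quadruple_invariant u v w z =
     ((bracket_ab_cd u v w z)^2 + (bracket_ab_cd u w v z)^2 + (bracket_ab_cd u z v w)^2)^3 /
     (bracket_ab_cd u v w z * bracket_ab_cd u w v z * bracket_ab_cd u z v w)^2"

lemma quadruple_invariant_swap:
  "quadruple_invariant v u w z = quadruple_invariant u v w z"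
  "quadruple_invariant u w v z = quadruple_invariant u v w z"
  "quadruple_invariant u v z w = quadruple_invariant u v w z"
  unfolding quadruple_invariant_def bracket_ab_cd_def
  by (intro arg_cong2[where f = "(/)"]; algebra)+

lemma quadruple_invariant_set:
  assumes "distinct [u, v, w, z]" "distinct [u', v', w', z']" "{u, v, w, z} = {u', v', w', z'}"
  shows "quadruple_invariant u v w z = quadruple_invariant u' v' w' z'"
proof -
  note swap = quadruple_invariant_swap
  have mem: "u' \<in> {u, v, w, z}" "v' \<in> {u, v, w, z}" "w' \<in> {u, v, w, z}" "z' \<in> {u, v, w, z}"
    using assms(3) by blast+
  then show ?thesis using assms(2) by (elim insertE emptyE) (simp_all, (metis swap)+)
qed

text \<open>A difference p - q is multiplied by D / ((c p + d) (c q + d)). Each bracket contains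
  every one of the four points once, so all three scale by the same k, and numerator and denominator
  both have degree 6 in the brackets.\<close>

lemma quadruple_invariant_moebius:
  assumes "a * d - b * c \<noteq> 0" "\<And>p q. (p, q) \<in> {(u, u'), (v, v'), (w, w'), (z, z')} \<Longrightarrow> moebius a b c d (Fin p) = Fin q"
  shows "quadruple_invariant u' v' w' z' = quadruple_invariant u v w z"
proof -
  define D where "D = a * d - b * c"
  have m: "c * p + d \<noteq> 0 \<and> q = (a * p + b) / (c * p + d)" if "moebius a b c d (Fin p) = Fin q" for p q
    using that by (simp add: hpt_def split: if_splits)
  have nz: "c * u + d \<noteq> 0" "c * v + d \<noteq> 0" "c * w + d \<noteq> 0" "c * z + d \<noteq> 0"
    and eq: "u' = (a * u + b) / (c * u + d)" "v' = (a * v + b) / (c * v + d)"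
      "w' = (a * w + b) / (c * w + d)" "z' = (a * z + b) / (c * z + d)"
    using m assms(2) by blast+
  have diff: "(a * p + b) / (c * p + d) - (a * q + b) / (c * q + d) = D * (p - q) / ((c * p + d) * (c * q + d))"
    if "c * p + d \<noteq> 0" "c * q + d \<noteq> 0" for p q
    unfolding D_def using that by (simp add: field_simps)
  define k where "k = D^2 / ((c * u + d) * (c * v + d) * (c * w + d) * (c * z + d))"
  have k: "k \<noteq> 0" using nz assms(1) by (simp add: k_def D_def)
  have br: "bracket_ab_cd u' v' w' z' = k * bracket_ab_cd u v w z"
    "bracket_ab_cd u' w' v' z' = k * bracket_ab_cd u w v z"
    "bracket_ab_cd u' z' v' w' = k * bracket_ab_cd u z v w"
    unfolding bracket_ab_cd_def eq using nz by (simp_all add: diff k_def power2_eq_square mult_ac)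
  have "quadruple_invariant u' v' w' z' =
     (k^6 * ((bracket_ab_cd u v w z)^2 + (bracket_ab_cd u w v z)^2 + (bracket_ab_cd u z v w)^2)^3) /
     (k^6 * (bracket_ab_cd u v w z * bracket_ab_cd u w v z * bracket_ab_cd u z v w)^2)"
    unfolding quadruple_invariant_def br by (intro arg_cong2[where f = "(/)"]; algebra)
  then show ?thesis using k by (simp add: quadruple_invariant_def)
qed

lemma quadruple_invariant_PGL2:
  assumes g: "g \<in> PGL2" and A: "distinct [u, v, w, z]" "distinct [u', v', w', z']"
    and im: "g ` Fin ` {u, v, w, z} = Fin ` {u', v', w', z'}"
  shows "quadruple_invariant u v w z = quadruple_invariant u' v' w' z'"
proof -
  obtain a b c d where g: "g = moebius a b c d" "a * d - b * c \<noteq> 0" using g by (auto simp: PGL2_def)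
  have "\<exists>q. g (Fin p) = Fin q" if "p \<in> {u, v, w, z}" for p using im that by blast
  then obtain h where h: "g (Fin p) = Fin (h p)" if "p \<in> {u, v, w, z}" for p by metis
  have "Fin ` h ` {u, v, w, z} = g ` Fin ` {u, v, w, z}" using h by auto
  then have hs: "{h u, h v, h w, h z} = {u', v', w', z'}" using im by (auto simp: inj_image_eq_iff inj_on_def)
  have "card {h u, h v, h w, h z} = 4" unfolding hs using A(2) by simp
  then have "distinct [h u, h v, h w, h z]"
    by (intro card_distinct) simp
  then have "quadruple_invariant (h u) (h v) (h w) (h z) = quadruple_invariant u' v' w' z'"
    using quadruple_invariant_set A hs by blast
  moreover have "quadruple_invariant (h u) (h v) (h w) (h z) = quadruple_invariant u v w z"
    by (rule quadruple_invariant_moebius[OF g(2)]) (use h in \<open>auto simp flip: g(1)\<close>)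
  ultimately show ?thesis by simp
qed

section \<open>Torsion in a one-parameter family\<close>

definition real_double :: "real \<Rightarrow> real \<Rightarrow> real" where
  "real_double b x = x * (x^3 + 12 * b * x - 8 * b^2) / (4 * (x^3 + (3 * x - b)^2))"

lemma flex_double_of_real:
  "flex_double (complex_of_real b) (complex_of_real x) = complex_of_real (real_double b x)"
  by (simp add: flex_double_def real_double_def flex_cubic_def)

text \<open>The abscissa 0 belongs to the flexes and is fixed by duplication, so an orbit that
  reaches 0 is certified.\<close>

lemma division_abscissa_of_iterate:
  "(real_double b ^^ k) x = 0 \<Longrightarrow> division_abscissa (complex_of_real b) (complex_of_real x)"
proof (induction k arbitrary: x)
  case 0
  then show ?case by (intro division_abscissa.three) (simp add: flex_double_def)
next
  case (Suc k)
  then have "division_abscissa (complex_of_real b) (complex_of_real (real_double b x))"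
    by (simp add: funpow_swap1)
  then show ?case unfolding flex_double_of_real[symmetric] by (rule division_abscissa.halve)
qed

text \<open>The interval is open at c, so compactness is not immediate. Positivity near c confines
  the zeros to [a, e], where a largest one exists.\<close>

lemma last_zero:
  fixes N :: "real \<Rightarrow> real"
  assumes cont: "continuous_on {a..<c} N" and "a < c" and neg: "N a < 0"
    and pos: "eventually (\<lambda>x. N x > 0) (at_left c)"
  obtains z where "a < z" "z < c" "N z = 0" "\<And>x. z < x \<Longrightarrow> x < c \<Longrightarrow> N x > 0"
proof -
  obtain d where d: "d < c" "\<And>x. d < x \<Longrightarrow> x < c \<Longrightarrow> N x > 0"
    using pos unfolding eventually_at_left_field by blast
  define e where "e = (max a d + c) / 2"
  have e: "a < e" "d < e" "e < c" using d(1) \<open>a < c\<close> by (auto simp: e_def)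
  have cont': "continuous_on {x..e} N" if "a \<le> x" for x
    by (rule continuous_on_subset[OF cont]) (use that e in auto)
  define Z where "Z = {x \<in> {a..e}. N x = 0}"
  have "Z = N -` {0} \<inter> {a..e}" by (auto simp: Z_def)
  then have "closed Z"
    using continuous_on_closed_vimage[of "{a..e}" N] cont'[of a] by simp
  moreover have "Z = {a..e} \<inter> Z" by (auto simp: Z_def)
  ultimately have "compact Z" using compact_Int_closed[OF compact_Icc] by metis
  have ivt: "\<exists>z\<ge>x. z \<le> e \<and> N z = 0" if "a \<le> x" "x \<le> e" "N x \<le> 0" for x
    using IVT'[of N x 0 e] that d(2)[of e] e cont'[of x] by auto
  obtain z0 where "z0 \<ge> a" "z0 \<le> e" "N z0 = 0" using ivt[of a] e neg by auto
  then have "Z \<noteq> {}" by (auto simp: Z_def)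
  then obtain z where z: "z \<in> Z" "\<And>x. x \<in> Z \<Longrightarrow> x \<le> z"
    using compact_attains_sup[OF \<open>compact Z\<close>] by blast
  show ?thesis
  proof
    show "N z = 0" "z < c" using z(1) e by (auto simp: Z_def)
    then show "a < z" using z(1) neg by (cases "z = a") (auto simp: Z_def)
    fix x assume x: "z < x" "x < c"
    show "N x > 0"
    proof (rule ccontr)
      assume "\<not> N x > 0"
      then have "x \<le> e" using d(2)[of x] x e by force
      then obtain y where "y \<ge> x" "y \<le> e" "N y = 0" using ivt[of x] \<open>\<not> N x > 0\<close> x \<open>a < z\<close> by auto
      then show False using z(2)[of y] x \<open>a < z\<close> by (auto simp: Z_def)
    qed
  qed
qed

text \<open>For t' = 4 m^3 the coordinate u = 4 - t' / x takes the value m + 1 at x = 4 m^3 / (3 -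
  m). The iterates are the abscissae of 2^k times that point.\<close>

definition doubling_iterate :: "nat \<Rightarrow> real \<Rightarrow> real" where
  "doubling_iterate k m = (real_double (4 * m^3) ^^ k) (4 * m^3 / (3 - m))"

text \<open>As m tends to 3 the abscissa 4 m^3 / (3 - m) tends to infinity, so each further doubling is
  negative just to the right of the last zero of the previous one, and has a later last zero.\<close>

definition positive_after_zero :: "real \<Rightarrow> (real \<Rightarrow> real) \<Rightarrow> bool" where
  "positive_after_zero a F \<longleftrightarrow> 0 < a \<and> a < 3 \<and> continuous_on {a..<3} F \<and> F a = 0 \<and>
     (\<forall>m. a < m \<longrightarrow> m < 3 \<longrightarrow> 0 < F m) \<and> filterlim F at_top (at_left 3)"

lemma positive_after_zero_double:
  assumes a: "0 < a" "a < 3" and cont: "continuous_on {a..<3} F" and pos: "\<And>m. a \<le> m \<Longrightarrow> m < 3 \<Longrightarrow> 0 < F m"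
    and lim: "filterlim F at_top (at_left 3)"
    and zero: "F a^3 + 12 * (4 * a^3) * F a - 8 * (4 * a^3)^2 = 0"
    and N: "\<And>m. a < m \<Longrightarrow> m < 3 \<Longrightarrow> F m^3 + 12 * (4 * m^3) * F m - 8 * (4 * m^3)^2 > 0"
  shows "positive_after_zero a (\<lambda>m. real_double (4 * m^3) (F m))"
proof -
  have den: "F m^3 + (3 * F m - 4 * m^3)^2 > 0" if "a \<le> m" "m < 3" for m
    using pos[OF that] by (simp add: add_pos_nonneg)
  have "continuous_on {a..<3} (\<lambda>m. real_double (4 * m^3) (F m))"
    unfolding real_double_def using den by (intro continuous_intros cont) force
  moreover have "filterlim (\<lambda>m. real_double (4 * m^3) (F m)) at_top (at_left 3)"
  proof (rule filterlim_at_top_mono)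
    \<comment> \<open>Doubling divides a large abscissa by about 4. The factor 1 / 16 leaves room
      for a factor 2 in the numerator and another in the denominator.\<close>
    show "filterlim (\<lambda>m. (1 / 16) * F m) at_top (at_left 3)"
      by (rule filterlim_tendsto_pos_mult_at_top[OF tendsto_const _ lim]) simp
    \<comment> \<open>For x at least 100 and b = 4 m^3 below 108, the term 8 b^2 is less than x^3 /
      2 and (3 x - b)^2 is at most x^3.\<close>
    have "eventually (\<lambda>m. F m \<ge> 100) (at_left 3)" using lim by (simp add: filterlim_at_top)
    moreover have "eventually (\<lambda>m. m \<in> {a<..<3}) (at_left 3)"
      using a eventually_at_leftI[of a "3::real" "\<lambda>m. m \<in> {a<..<3}"] by simp
    ultimately show "eventually (\<lambda>m. (1 / 16) * F m \<le> real_double (4 * m^3) (F m)) (at_left 3)"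
    proof eventually_elim
      case (elim m)
      define x where "x = F m"
      define b where "b = 4 * m^3"
      have m: "0 < m" "m < 3" "a \<le> m" using elim a by auto
      have "m^3 < 3^3" using m by (intro power_strict_mono) auto
      then have b: "0 < b" "b < 108" using m by (auto simp: b_def)
      have x: "x \<ge> 100" using elim by (simp add: x_def)
      have "x^3 \<ge> 100^3" using x by (intro power_mono) auto
      moreover have "b^2 < 108^2" using b by (intro power_strict_mono) auto
      moreover have "12 * b * x \<ge> 0" using b x by simp
      ultimately have n: "x^3 / 2 \<le> x^3 + 12 * b * x - 8 * b^2" by simp
      have "\<bar>3 * x - b\<bar> \<le> 3 * x" using b x by auto
      then have "(3 * x - b)^2 \<le> (3 * x)^2" using x by (intro power2_le_iff_abs_le[THEN iffD2]) auto
      also have "(3 * x)^2 = 9 * x^2" by (simp add: power2_eq_square)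
      also have "\<dots> \<le> x * x^2" using x by (intro mult_right_mono) auto
      finally have d: "x^3 + (3 * x - b)^2 \<le> 2 * x^3" by (simp add: power3_eq_cube power2_eq_square)
      have d0: "0 < x^3 + (3 * x - b)^2" using x by (simp add: add_pos_nonneg)
      have "x * (4 * (x^3 + (3 * x - b)^2)) \<le> x * (4 * (2 * x^3))" using d x by (intro mult_left_mono) auto
      also have "\<dots> = 16 * (x * (x^3 / 2))" by simp
      also have "\<dots> \<le> 16 * (x * (x^3 + 12 * b * x - 8 * b^2))" using n x by (intro mult_left_mono) auto
      finally have "x / 16 \<le> x * (x^3 + 12 * b * x - 8 * b^2) / (4 * (x^3 + (3 * x - b)^2))"
        using d0 by (simp add: field_simps)
      then show ?case by (simp add: real_double_def x_def b_def)
    qed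
  qed
  moreover have "real_double (4 * m^3) (F m) > 0" if "a < m" "m < 3" for m
    unfolding real_double_def using pos[of m] N[OF that] den[of m] that by (intro divide_pos_pos mult_pos_pos) auto
  ultimately show ?thesis using a zero by (simp add: positive_after_zero_def real_double_def)
qed

lemma positive_after_zero_next:
  assumes "positive_after_zero a F"
  obtains a' where "a' > a" "positive_after_zero a' (\<lambda>m. real_double (4 * m^3) (F m))"
proof -
  have a: "0 < a" "a < 3" and cont: "continuous_on {a..<3} F" and F: "F a = 0" "\<And>m. a < m \<Longrightarrow> m < 3 \<Longrightarrow> 0 < F m"
    and lim: "filterlim F at_top (at_left 3)"
    using assms by (auto simp: positive_after_zero_def)
  let ?N = "\<lambda>m. F m^3 + 12 * (4 * m^3) * F m - 8 * (4 * m^3)^2"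
  have "continuous_on {a..<3} ?N" by (intro continuous_intros cont)
  moreover have "?N a < 0" using F a by simp
  moreover have "eventually (\<lambda>m. ?N m > 0) (at_left 3)"
  proof -
    \<comment> \<open>72 is 2 * 108 / 3: since 4 m^3 < 108, it makes 3 F m - 2 (4 m^3)
      positive.\<close>
    have "eventually (\<lambda>m. F m \<ge> 72) (at_left 3)" using lim by (simp add: filterlim_at_top)
    moreover have "eventually (\<lambda>m. m \<in> {a<..<3}) (at_left 3)"
      using a eventually_at_leftI[of a "3::real" "\<lambda>m. m \<in> {a<..<3}"] by simp
    ultimately show ?thesis
    proof eventually_elim
      case (elim m)
      have "m^3 < 3^3" using elim a by (intro power_strict_mono) auto
      then have b: "0 < 4 * m^3" "4 * m^3 < 108" using elim a by auto
      have "0 < 4 * (4 * m^3) * (3 * F m - 2 * (4 * m^3))" using b elim by (intro mult_pos_pos) auto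
      moreover have "F m^3 > 0" using elim by simp
      moreover have "?N m = F m^3 + 4 * (4 * m^3) * (3 * F m - 2 * (4 * m^3))" by algebra
      ultimately show ?case by linarith
    qed
  qed
  ultimately obtain z where z: "a < z" "z < 3" "?N z = 0" "\<And>x. z < x \<Longrightarrow> x < 3 \<Longrightarrow> ?N x > 0"
    using last_zero[of a 3 ?N] a by blast
  have "positive_after_zero z (\<lambda>m. real_double (4 * m^3) (F m))"
    by (rule positive_after_zero_double) (use a F lim z continuous_on_subset[OF cont] in auto)
  then show ?thesis using that z by blast
qed

text \<open>The initial abscissa 4 m^3 / (3 - m) has no zero in (0, 3), so the chain starts with the
  first doubling.\<close>

lemma positive_after_zero_start: "\<exists>a. positive_after_zero a (doubling_iterate 1)"
proof -
  \<comment> \<open>This is the numerator factor of the first doubling divided by (4 m^3)^2.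
    Undivided it would vanish at m = 0, where a negative value is wanted.\<close>
  let ?M = "\<lambda>m::real. 4 * m^3 / (3 - m)^3 + 12 / (3 - m) - 8"
  have inv: "filterlim (\<lambda>m::real. 1 / (3 - m)) at_top (at_left 3)"
  proof -
    have "filterlim (\<lambda>m::real. 3 - m) (at_right 0) (at_left 3)"
      unfolding filterlim_at by (auto intro!: tendsto_eq_intros eventually_at_leftI[of 0])
    then have "filterlim (\<lambda>m::real. inverse (3 - m)) at_top (at_left 3)"
      by (rule filterlim_compose[OF filterlim_inverse_at_top_right])
    then show ?thesis by (simp add: inverse_eq_divide)
  qed
  have ev: "eventually (\<lambda>m::real. m \<in> {1<..<3}) (at_left 3)"
    using eventually_at_leftI[of 1 "3::real" "\<lambda>m. m \<in> {1<..<3}"] by simp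
  have "continuous_on {0..<3} ?M" by (intro continuous_intros) auto
  moreover have "?M 0 < 0" by simp
  moreover have "eventually (\<lambda>m. ?M m > 0) (at_left 3)"
  proof -
    have "eventually (\<lambda>m::real. 1 / (3 - m) \<ge> 1) (at_left 3)" using inv by (simp add: filterlim_at_top)
    then show ?thesis using ev
    proof eventually_elim
      case (elim m)
      have "12 / (3 - m) \<ge> 12" using elim by (simp add: field_simps)
      moreover have "4 * m^3 / (3 - m)^3 > 0" using elim by simp
      ultimately show ?case by simp
    qed
  qed
  ultimately obtain a where a: "0 < a" "a < 3" "?M a = 0" "\<And>x. a < x \<Longrightarrow> x < 3 \<Longrightarrow> ?M x > 0"
    using last_zero[of 0 3 ?M] by auto
  let ?F = "\<lambda>m::real. 4 * m^3 / (3 - m)"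
  have N: "?F m^3 + 12 * (4 * m^3) * ?F m - 8 * (4 * m^3)^2 = (4 * m^3)^2 * ?M m" for m
  proof -
    define t where "t = 1 / (3 - m)"
    have "?F m = 4 * m^3 * t" "?M m = 4 * m^3 * t^3 + 12 * t - 8"
      by (simp_all add: t_def power_one_over)
    then show ?thesis by algebra
  qed
  have "positive_after_zero a (\<lambda>m. real_double (4 * m^3) (?F m))"
  proof (rule positive_after_zero_double)
    show "continuous_on {a..<3} ?F" by (intro continuous_intros) auto
    show "filterlim ?F at_top (at_left 3)"
    proof (rule filterlim_at_top_mono[OF inv])
      show "eventually (\<lambda>m. 1 / (3 - m) \<le> ?F m) (at_left 3)"
        using ev
      proof eventually_elim
        case (elim m)
        then have "1 \<le> m^3" by (intro one_le_power) auto
        then have "1 \<le> 4 * m^3" by linarith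
        then show ?case using elim by (intro divide_right_mono) auto
      qed
    qed
    show "?F a^3 + 12 * (4 * a^3) * ?F a - 8 * (4 * a^3)^2 = 0" unfolding N a(3) by simp
    show "?F m^3 + 12 * (4 * m^3) * ?F m - 8 * (4 * m^3)^2 > 0" if "a < m" "m < 3" for m
      unfolding N using a(4)[OF that] a(1) that by (intro mult_pos_pos) auto
  qed (use a in auto)
  moreover have "(\<lambda>m. real_double (4 * m^3) (?F m)) = doubling_iterate 1" by (simp add: doubling_iterate_def fun_eq_iff)
  ultimately show ?thesis by auto
qed

lemma infinite_zeros_of_iterates: "infinite {m. 0 < m \<and> m < 3 \<and> (\<exists>k. doubling_iterate k m = 0)}"
proof -
  let ?Y = "{m. \<exists>k. positive_after_zero m (doubling_iterate k)}"
  have "infinite ?Y"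
  proof (rule infinite_growing)
    show "?Y \<noteq> {}" using positive_after_zero_start by blast
    fix a assume "a \<in> ?Y"
    then obtain k where "positive_after_zero a (doubling_iterate k)" by blast
    then obtain a' where "a' > a" "positive_after_zero a' (\<lambda>m. real_double (4 * m^3) (doubling_iterate k m))" by (rule positive_after_zero_next)
    moreover have "(\<lambda>m. real_double (4 * m^3) (doubling_iterate k m)) = doubling_iterate (Suc k)"
      by (simp add: doubling_iterate_def fun_eq_iff)
    ultimately show "\<exists>y\<in>?Y. y > a" by auto
  qed
  then show ?thesis by (rule infinite_super[rotated]) (auto simp: positive_after_zero_def)
qed

section \<open>Pairs of covers with 22 common torsion values\<close>

lemma quadruple_invariant_antipodal:
  assumes "\<alpha> \<noteq> 0"
  shows "quadruple_invariant \<alpha> (- \<alpha>) (1 / \<alpha>) (- 1 / \<alpha>) =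
    (24 + 2 * (\<alpha>^2 + 1 / \<alpha>^2)^2)^3 / (16 * ((\<alpha>^2 + 1 / \<alpha>^2)^2 - 4)^2)"
proof -
  define q where "q = 1 / \<alpha>"
  have q: "\<alpha> * q = 1" using assms by (simp add: q_def)
  have q2: "1 / \<alpha>^2 = q^2" "- 1 / \<alpha> = - q" by (simp_all add: q_def power_one_over)
  define l where "l = \<alpha>^2 + q^2"
  have br: "bracket_ab_cd \<alpha> (- \<alpha>) q (- q) = 4" "bracket_ab_cd \<alpha> q (- \<alpha>) (- q) = - (l - 2)"
    "bracket_ab_cd \<alpha> (- q) (- \<alpha>) q = - (l + 2)"
    unfolding bracket_ab_cd_def l_def using q by algebra+
  have e: "4^2 + (- (l - 2))^2 + (- (l + 2))^2 = 24 + 2 * l^2" "(4 * - (l - 2) * - (l + 2))^2 = 16 * (l^2 - 4)^2"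
    by algebra+
  then show ?thesis unfolding quadruple_invariant_def q2 q_def[symmetric] br l_def[symmetric] by (simp only: e)
qed

lemma distinct_antipodal:
  fixes \<alpha> :: complex
  assumes "\<alpha> \<noteq> 0" "(\<alpha>^2 + 1 / \<alpha>^2)^2 \<noteq> 4"
  shows "distinct [\<alpha>, - \<alpha>, 1 / \<alpha>, - 1 / \<alpha>]"
proof -
  have ne: "\<alpha>^2 \<noteq> 1" "\<alpha>^2 \<noteq> - 1"
    using assms(2) by auto
  define q where "q = 1 / \<alpha>"
  have q: "\<alpha> * q = 1" "q \<noteq> 0" "- 1 / \<alpha> = - q" using assms(1) by (simp_all add: q_def)
  have "\<alpha> \<noteq> q" using ne(1) q(1) by (auto simp: power2_eq_square)
  moreover have "\<alpha> \<noteq> - q"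
  proof
    assume "\<alpha> = - q"
    then have "\<alpha>^2 = - 1" using q(1) by algebra
    then show False using ne by simp
  qed
  moreover have "z \<noteq> - z" if "z \<noteq> 0" for z :: complex
    using that by (metis add_eq_0_iff mult_2 mult_eq_0_iff zero_neq_numeral)
  ultimately show ?thesis using assms(1) q(2) unfolding q(3) q_def[symmetric] by fastforce
qed

section \<open>The curves E(t) and their covers in the coordinate u\<close>

definition flex_weierstrass :: "complex \<Rightarrow> weierstrass" where
  "flex_weierstrass t = Weierstrass 0 9 0 (- (6 * t)) (t^2)"

definition torsion_abscissa :: "complex \<Rightarrow> complex \<Rightarrow> bool" where
  "torsion_abscissa t x \<longleftrightarrow> (\<forall>y. y^2 = flex_cubic t x \<longrightarrow> Affine x y \<in> torsion (flex_weierstrass t))"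

text \<open>One 32nd of the j-invariant of \<open>flex_weierstrass t\<close>, the normalisation that
  fits \<open>quadruple_invariant\<close>.\<close>

definition flex_invariant :: "complex \<Rightarrow> complex" where
  "flex_invariant t = - 216 * (9 + 2 * t)^3 / (t^3 * (t + 4))"

text \<open>The function level A B C is the coordinate on the projective line with values
  infinity, -2 and 2 at A, B and C, and level_infty A B C is its value at infinity.\<close>

definition level_infty :: "complex \<Rightarrow> complex \<Rightarrow> complex \<Rightarrow> complex" where
  "level_infty A B C = 2 * (B + C - 2 * A) / (C - B)"

definition level :: "complex \<Rightarrow> complex \<Rightarrow> complex \<Rightarrow> complex \<Rightarrow> complex" where
  "level A B C u = level_infty A B C + 4 * (A - B) * (A - C) / ((C - B) * (A - u))"

lemma (in flex_curve) E_eq: "E = flex_weierstrass t"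
  by (simp add: E_def flex_weierstrass_def)

lemma torsion_abscissa_of_division:
  assumes "division_abscissa t x" "t \<noteq> 0" "t \<noteq> - 4"
  shows "torsion_abscissa t x"
proof -
  interpret flex_curve t by unfold_locales (use assms in auto)
  show ?thesis unfolding torsion_abscissa_def
    using torsion_of_division_abscissa[OF assms(1)] unfolding f_eq E_eq by blast
qed

text \<open>In the coordinate u = t / x the branch points of the abscissa are 0 and the roots of
  u (u - 3)^2 = - t. The hypotheses say that A, B and C are these roots.\<close>

lemma flex_cover:
  assumes t: "t \<noteq> 0" "t \<noteq> - 4" and C: "C = 6 - A - B" and BC: "B * C = (A - 3)^2"
    and tA: "t = - (A * (A - 3)^2)" and ne: "A \<noteq> B" "A \<noteq> C" "B \<noteq> C"
  obtains \<phi> \<alpha> where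
    "elliptic_curve (flex_weierstrass t)" "double_cover (flex_weierstrass t) \<phi>"
    "ramified_at (flex_weierstrass t) \<phi> Origin"
    "\<phi> ` n_torsion (flex_weierstrass t) 2 = Fin ` {\<alpha>, - \<alpha>, 1 / \<alpha>, - 1 / \<alpha>}"
    "distinct [\<alpha>, - \<alpha>, 1 / \<alpha>, - 1 / \<alpha>]" "\<alpha>^2 + 1 / \<alpha>^2 = level A B C 0"
    "quadruple_invariant \<alpha> (- \<alpha>) (1 / \<alpha>) (- 1 / \<alpha>) = flex_invariant t"
    "Fin 0 \<in> \<phi> ` torsion (flex_weierstrass t)" "Infty \<in> \<phi> ` torsion (flex_weierstrass t)"
    "\<And>v. v \<noteq> 0 \<Longrightarrow> v^2 + 1 / v^2 = level_infty A B C \<Longrightarrow> Fin v \<in> \<phi> ` torsion (flex_weierstrass t)"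
    "\<And>v u. v \<noteq> 0 \<Longrightarrow> v^2 + 1 / v^2 = level A B C u \<Longrightarrow> u \<noteq> 0 \<Longrightarrow> u \<noteq> A \<Longrightarrow> torsion_abscissa t (t / u) \<Longrightarrow>
       Fin v \<in> \<phi> ` torsion (flex_weierstrass t)"
proof -
  interpret flex_curve t by unfold_locales (use t in auto)
  have ABC: "A * B * C = - t" using BC tA by algebra
  then have nz: "A \<noteq> 0" "B \<noteq> 0" "C \<noteq> 0" using t by auto
  define r where "r = csqrt (t * (A - B) / (A * B))"
  define s where "s = csqrt (t * (A - C) / (A * C))"
  define \<alpha> where "\<alpha> = csqrt ((s - r) / (s + r))"
  have r: "r^2 = t * (A - B) / (A * B)" and s: "s^2 = t * (A - C) / (A * C)" by (simp_all add: r_def s_def)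
  have eB: "t / A + r^2 = t / B" and eC: "t / A + s^2 = t / C" unfolding r s using nz by (simp_all add: field_simps)
  interpret M: marked_cubic 9 "- (6 * t)" "t^2" "t / A" r s \<alpha>
  proof
    fix x
    have "A * B * C * (x^3 + 9 * x^2 + - (6 * t) * x + t^2) = (A * x - t) * (B * x - t) * (C * x - t)"
      using C BC tA by algebra
    also have "\<dots> = A * B * C * ((x - t / A) * (x - t / B) * (x - t / C))" using nz by (simp add: field_simps)
    finally have "x^3 + 9 * x^2 + - (6 * t) * x + t^2 = (x - t / A) * (x - t / B) * (x - t / C)"
      using nz by (metis mult_left_cancel mult_eq_0_iff)
    then show "x^3 + 9 * x^2 + - (6 * t) * x + t^2 = (x - t / A) * (x - t / A - r^2) * (x - t / A - s^2)"
      unfolding diff_diff_eq eB eC .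
  next
    show "r \<noteq> 0" "s \<noteq> 0" using t nz ne by (auto simp: r_def s_def)
    show "r^2 \<noteq> s^2"
    proof
      assume "r^2 = s^2"
      then have "t / B = t / C" using eB eC by metis
      then have "t * C = t * B" using nz(2,3) by (metis frac_eq_eq)
      then show False using t(1) ne(3) by (metis mult_left_cancel)
    qed
    show "\<alpha>^2 = (s - r) / (s + r)" by (simp add: \<alpha>_def)
  qed
  have E: "E = flex_weierstrass t" by (rule E_eq)
  have tor: "torsion_abscissa t x \<Longrightarrow> y^2 = f x \<Longrightarrow> Affine x y \<in> torsion E" for x y
    by (simp add: torsion_abscissa_def f_eq E)
  have rs: "(r^2 - s^2) * (A * B * C) = t * A * (C - B)" "(r^2 + s^2) * (A * B * C) = t * (A * C + A * B - 2 * B * C)"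
    "r^2 * s^2 * (A * B * C) * A = t^2 * (A - B) * (A - C)"
    unfolding r s using nz by (simp_all add: field_simps power2_eq_square)
  have rs0: "r^2 - s^2 \<noteq> 0" using M.rs by simp
  have CB: "C - B \<noteq> 0" using ne by simp
  have lev: "A * (C - B) * (level A B C u) = 2 * A * (B + C - 2 * A) + 4 * A * (A - B) * (A - C) / (A - u)" for u
  proof -
    define i where "i = 1 / (A - u)"
    define k where "k = 1 / (C - B)"
    have k: "(C - B) * k = 1" using CB by (simp add: k_def)
    have "level A B C u = 2 * (B + C - 2 * A) * k + 4 * (A - B) * (A - C) * k * i"
      by (simp add: level_def level_infty_def i_def k_def)
    then have "A * (C - B) * (level A B C u) = 2 * A * (B + C - 2 * A) + 4 * A * (A - B) * (A - C) * i"
      using k by algebra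
    then show ?thesis by (simp add: i_def)
  qed
  have dbl: "A * (C - B) * M.doubled_cover_x x = 4 * t * (A - B) * (A - C) / (A * (x - t / A)) - 2 * (A * C + A * B - 2 * B * C)" for x
  proof -
    define i where "i = 1 / (x - t / A)"
    have "t * (A * (C - B)) * M.doubled_cover_x x = (A * B * C) * ((r^2 - s^2) * M.doubled_cover_x x)"
      using rs(1) by algebra
    also have "(r^2 - s^2) * M.doubled_cover_x x = 4 * (r^2 * s^2) * i - 2 * (r^2 + s^2)"
      unfolding M.doubled_cover_x_def i_def using rs0 by (simp add: mult_ac)
    also have "(A * B * C) * \<dots> = 4 * (r^2 * s^2 * (A * B * C) * A) / A * i - 2 * ((r^2 + s^2) * (A * B * C))"
      using nz by (simp add: algebra_simps)
    also have "\<dots> = t * (4 * t * (A - B) * (A - C) / A * i - 2 * (A * C + A * B - 2 * B * C))"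
      unfolding rs by (simp add: algebra_simps power2_eq_square)
    finally have "A * (C - B) * M.doubled_cover_x x = 4 * t * (A - B) * (A - C) / A * i - 2 * (A * C + A * B - 2 * B * C)"
      using t(1) by (metis mult.assoc mult_left_cancel)
    then show ?thesis by (simp add: i_def)
  qed
  have ACB: "A * (C - B) \<noteq> 0" using nz CB by simp
  \<comment> \<open>The abscissa 0 of the flexes is the point u = infinity.\<close>
  have dbl_0: "M.doubled_cover_x 0 = level_infty A B C"
  proof -
    have e: "A * (0 - t / A) = - t" using nz by simp
    have "A * (C - B) * M.doubled_cover_x 0 = - (4 * ((A - B) * (A - C))) - 2 * (A * C + A * B - 2 * B * C)"
      unfolding dbl e using t by simp
    also have "\<dots> = 2 * A * (B + C - 2 * A)" by algebra
    also have "\<dots> = A * (C - B) * level_infty A B C" unfolding level_infty_def using CB by simp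
    finally show ?thesis using ACB by (metis mult_left_cancel)
  qed
  have dbl_u: "M.doubled_cover_x (t / u) = level A B C u" if u: "u \<noteq> 0" "u \<noteq> A" for u
  proof -
    define i where "i = 1 / (A - u)"
    have i: "(A - u) * i = 1" using u by (simp add: i_def)
    have e: "A * (t / u - t / A) = t * (A - u) / u" using nz u by (simp add: field_simps)
    have "A * (C - B) * M.doubled_cover_x (t / u) = 4 * (A - B) * (A - C) * u * i - 2 * (A * C + A * B - 2 * B * C)"
      unfolding dbl e i_def using t u by (simp add: mult_ac)
    also have "\<dots> = 2 * A * (B + C - 2 * A) + 4 * A * (A - B) * (A - C) * i" using i by algebra
    also have "\<dots> = A * (C - B) * level A B C u" unfolding lev i_def by simp
    finally show ?thesis using ACB by (metis mult_left_cancel)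
  qed
  define l where "l = \<alpha>^2 + 1 / \<alpha>^2"
  have l: "A * (C - B) * l = - 2 * (A * C + A * B - 2 * B * C)"
  proof -
    have "1 / \<alpha>^2 = (s + r) / (s - r)" unfolding M.alpha_sq by simp
    then have "(r^2 - s^2) * l = (r^2 - s^2) * ((s - r) / (s + r) + (s + r) / (s - r))" unfolding l_def M.alpha_sq by simp
    also have "\<dots> = (r^2 - s^2) * ((s - r)^2 + (s + r)^2) / ((s + r) * (s - r))"
      using M.r_plus_s by (simp add: add.commute[of r s] add_frac_eq power2_eq_square)
    also have "(s + r) * (s - r) = - (r^2 - s^2)" by algebra
    also have "(r^2 - s^2) * ((s - r)^2 + (s + r)^2) / - (r^2 - s^2) = - ((s - r)^2 + (s + r)^2)"
      using nonzero_mult_div_cancel_left[OF rs0] by (simp only: divide_minus_right)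
    also have "\<dots> = - 2 * (r^2 + s^2)" by algebra
    finally have "(A * B * C) * ((r^2 - s^2) * l) = (A * B * C) * (- 2 * (r^2 + s^2))" by simp
    then have "t * (A * (C - B) * l) = t * (- 2 * (A * C + A * B - 2 * B * C))"
      using rs(1,2) by algebra
    then show ?thesis using t(1) by (metis mult_left_cancel)
  qed
  have l0: "l = level A B C 0"
  proof -
    have "A * (C - B) * level A B C 0 = 2 * A * (B + C - 2 * A) + 4 * (A - B) * (A - C)"
      unfolding lev using nz by simp
    also have "\<dots> = A * (C - B) * l" unfolding l by algebra
    finally show ?thesis using ACB by (metis mult_left_cancel)
  qed
  \<comment> \<open>Interchanging B and C changes the sign of l, but l^2 and D depend on A alone.
    The invariant can therefore be computed with polynomials in A.\<close>
  define D where "D = (A * (C - B))^2"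
  have D0: "D \<noteq> 0" using ACB by (simp add: D_def)
  have D: "D = 3 * A^3 * (4 - A)" unfolding D_def using C BC by algebra
  have Dl: "D * l^2 = (- 2 * A * (6 - A) + 4 * (A - 3)^2)^2"
  proof -
    have "D * l^2 = (A * (C - B) * l)^2" unfolding D_def by algebra
    then show ?thesis unfolding l using C BC by algebra
  qed
  have h1: "D * (24 + 2 * l^2) = 288 * (9 + 2 * t)"
  proof -
    have "D * (24 + 2 * l^2) = 24 * D + 2 * (D * l^2)" by algebra
    also have "\<dots> = 288 * (9 + 2 * t)" unfolding Dl unfolding D tA by algebra
    finally show ?thesis .
  qed
  have h2: "D * (l^2 - 4) = 48 * (A - 3)^3 * (A - 1)"
  proof -
    have "D * (l^2 - 4) = D * l^2 - 4 * D" by algebra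
    also have "\<dots> = 48 * (A - 3)^3 * (A - 1)" unfolding Dl unfolding D by algebra
    finally show ?thesis .
  qed
  have "A \<noteq> 3" "A \<noteq> 1" using t tA by auto
  then have l4: "l^2 - 4 \<noteq> 0" using h2 by auto
  have inv: "(24 + 2 * l^2)^3 / (16 * (l^2 - 4)^2) = flex_invariant t"
  proof -
    have "t + 4 \<noteq> 0" using t by (simp add: add_eq_0_iff2)
    then have d: "t^3 * (t + 4) \<noteq> 0" "16 * (l^2 - 4)^2 \<noteq> 0" using t l4 by auto
    have "D^3 * ((24 + 2 * l^2)^3 * (t^3 * (t + 4))) = (D * (24 + 2 * l^2))^3 * (t^3 * (t + 4))" by algebra
    also have "\<dots> = (- 216 * (9 + 2 * t)^3) * (16 * (48 * (A - 3)^3 * (A - 1))^2) * D"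
      unfolding h1 unfolding D tA by algebra
    also have "\<dots> = D^3 * ((- 216 * (9 + 2 * t)^3) * (16 * (l^2 - 4)^2))" unfolding h2[symmetric] by algebra
    finally have "(24 + 2 * l^2)^3 * (t^3 * (t + 4)) = (- 216 * (9 + 2 * t)^3) * (16 * (l^2 - 4)^2)"
      using D0 by (metis mult_left_cancel power_not_zero)
    then show ?thesis unfolding flex_invariant_def using d by (subst frac_eq_eq) auto
  qed
  show ?thesis
  proof (rule that[of M.cover \<alpha>], unfold E[symmetric])
    show "elliptic_curve E" by (rule elliptic_curve_E)
    show "double_cover E M.cover" by (rule M.double_cover)
    show "ramified_at E M.cover Origin" by (rule M.ramified_Origin)
    show "M.cover ` n_torsion E 2 = Fin ` {\<alpha>, - \<alpha>, 1 / \<alpha>, - 1 / \<alpha>}" by (rule M.cover_n_torsion_2)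
    show "distinct [\<alpha>, - \<alpha>, 1 / \<alpha>, - 1 / \<alpha>]"
      using l4 by (intro distinct_antipodal M.alpha_nonzero) (simp add: l_def)
    show "\<alpha>^2 + 1 / \<alpha>^2 = level A B C 0" using l0 by (simp add: l_def)
    show "quadruple_invariant \<alpha> (- \<alpha>) (1 / \<alpha>) (- 1 / \<alpha>) = flex_invariant t"
      unfolding quadruple_invariant_antipodal[OF M.alpha_nonzero] l_def[symmetric] by (rule inv)
    show "Fin 0 \<in> M.cover ` torsion E" by (rule M.Fin_0_in_cover_torsion)
    show "Infty \<in> M.cover ` torsion E" by (rule M.Infty_in_cover_torsion)
    show "Fin v \<in> M.cover ` torsion E" if "v \<noteq> 0" "v^2 + 1 / v^2 = level_infty A B C" for v
    proof (rule M.Fin_in_cover_torsion[of 0])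
      have "division_abscissa t 0" by (rule division_abscissa.three) (simp add: flex_double_def)
      then show "y^2 = f 0 \<Longrightarrow> Affine 0 y \<in> torsion E" for y by (rule torsion_of_division_abscissa)
    qed (use t nz that dbl_0 in auto)
    show "Fin v \<in> M.cover ` torsion E"
      if "v \<noteq> 0" "v^2 + 1 / v^2 = level A B C u" "u \<noteq> 0" "u \<noteq> A" "torsion_abscissa t (t / u)" for v u
      by (rule M.Fin_in_cover_torsion[of "t / u"]) (use t nz that dbl_u tor in \<open>auto simp: frac_eq_eq\<close>)
  qed
qed

text \<open>B and C solve a quadratic equation with discriminant 3 A (4 - A). The critical values of
  u (u - 3)^2 are 0, at u = 3, and 4, at u = 1; every other fibre has three distinct points.\<close>

lemma other_roots:
  fixes A :: complex
  assumes "A * (A - 3)^2 \<noteq> 0" "A * (A - 3)^2 \<noteq> 4"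
  obtains B C where "C = 6 - A - B" "B * C = (A - 3)^2" "A \<noteq> B" "A \<noteq> C" "B \<noteq> C"
proof -
  define d where "d = csqrt (3 * A * (4 - A))"
  define B where "B = (6 - A + d) / 2"
  define C where "C = 6 - A - B"
  have d: "d^2 = 3 * A * (4 - A)" by (simp add: d_def)
  have B: "2 * B = 6 - A + d" by (simp add: B_def)
  have BC: "B * C = (A - 3)^2" using B d unfolding C_def by algebra
  have ne: "A \<noteq> 0" "A \<noteq> 1" "A \<noteq> 3" "A \<noteq> 4" using assms by auto
  have self: False if "A * (6 - 2 * A) = (A - 3)^2"
  proof -
    have "(A - 3) * (A - 1) = 0" using that by algebra
    then show False using ne by simp
  qed
  have "A \<noteq> B" using self BC by (auto simp: C_def)
  moreover have "A \<noteq> C"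
  proof
    assume "A = C"
    then have "B = 6 - 2 * A" by (simp add: C_def algebra_simps)
    then show False using self BC \<open>A = C\<close> by (simp add: mult.commute)
  qed
  moreover have "B \<noteq> C"
  proof
    assume "B = C"
    then have "d = 0" using B unfolding C_def by algebra
    then show False using d ne by simp
  qed
  ultimately show ?thesis using that[of C B] BC C_def by blast
qed

lemma cubic_root_exists: "\<exists>A::complex. A * (A - 3)^2 = c"
proof -
  have "\<not> constant (poly [:- c, 9, - 6, 1:])" by (simp add: constant_degree)
  then obtain A where "poly [:- c, 9, - 6, 1:] A = 0" using fundamental_theorem_of_algebra by blast
  then have "A * (A - 3)^2 - c = 0" by (simp add: algebra_simps power2_eq_square)
  then show ?thesis by auto
qed

lemma torsion_abscissa_partner:
  assumes t: "t \<noteq> 0" "t \<noteq> - 4" and V: "V2 = 6 - V0 - V1" "V1 * V2 = (V0 - 3)^2"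
    and ne: "V0 \<noteq> 0" "V0 \<noteq> 4" "V1 \<noteq> 0" "V2 \<noteq> 0"
    and d: "division_abscissa t (t / V0)" "division_abscissa (- 4 - t) ((- 4 - t) / (4 - V0))"
  shows "torsion_abscissa t (t / V1)"
  unfolding torsion_abscissa_def
proof (intro allI impI)
  interpret flex_curve t by unfold_locales (use t in auto)
  fix y assume y: "y^2 = flex_cubic t (t / V1)"
  have e: "V0 - 2 + 2 = V0" "V1 - 2 + 2 = V1" "2 - (V0 - 2) = 4 - V0" by simp_all
  have "Affine (t / (V1 - 2 + 2)) y \<in> torsion E"
  proof (rule torsion_partner[of "V1 - 2" "V0 - 2"])
    show "(V1 - 2)^2 = 3 - (V0 - 2) * (V1 - 2) - (V0 - 2)^2" using V by algebra
    show "V0 - 2 + (V1 - 2) \<noteq> 2"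
    proof
      assume "V0 - 2 + (V1 - 2) = 2"
      then have "V0 + V1 = 6" by (simp add: algebra_simps)
      then have "V2 = 0" using V(1) by (simp add: diff_diff_eq)
      then show False using ne by simp
    qed
    show "V0 - 2 \<noteq> 2" "V0 - 2 \<noteq> - 2" "V1 - 2 \<noteq> - 2" using ne by (auto simp: algebra_simps)
  qed (use d y in \<open>simp_all only: e f_eq\<close>)
  then show "Affine (t / V1) y \<in> torsion (flex_weierstrass t)" by (simp only: e E_eq)
qed

lemma torsion_abscissa_root:
  assumes "t \<noteq> 0" "t \<noteq> - 4" "B * (B - 3)^2 = - t"
  shows "torsion_abscissa t (t / B)"
proof (intro torsion_abscissa_of_division division_abscissa.two assms)
  have "B \<noteq> 0" using assms by auto
  have "flex_cubic t (t / B) = t^2 * (t + B * (B - 3)^2) / B^3"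
    unfolding flex_cubic_def using \<open>B \<noteq> 0\<close> by (simp add: field_simps) algebra
  then show "flex_cubic t (t / B) = 0" using assms by simp
qed

text \<open>The fibre over w of the covering of degree 4 of the projective line which multiplication by 2
  induces on the quotients of the curve by the sign.\<close>

definition fourfold :: "complex \<Rightarrow> complex set" where
  "fourfold w = {v. v \<noteq> 0 \<and> v^2 + 1 / v^2 = w}"

text \<open>v^2 is found as a root of z^2 - w z + 1, and v, - v, 1 / v, - 1 / v all lie over w. They
  are distinct unless w is 2 or - 2, the finite branch values.\<close>

lemma fourfold_card: "\<exists>Q \<subseteq> fourfold w. finite Q \<and> card Q = (if w^2 = 4 then 2 else 4)"
proof -
  define z where "z = (w + csqrt (w^2 - 4)) / 2"
  define v where "v = csqrt z"
  have "(csqrt (w^2 - 4))^2 = w^2 - 4" by simp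
  moreover have "2 * z = w + csqrt (w^2 - 4)" by (simp add: z_def)
  then have "csqrt (w^2 - 4) = 2 * z - w" by simp
  ultimately have "4 * (z * (w - z)) = 4 * 1" by algebra
  then have z: "z * (w - z) = 1" by simp
  have vz: "v^2 = z" by (simp add: v_def)
  have v0: "v \<noteq> 0" using z vz by auto
  have "1 / z = w - z" using z by (metis mult_zero_left nonzero_mult_div_cancel_left zero_neq_one)
  then have v: "v^2 + 1 / v^2 = w" by (simp add: vz)
  then have Q: "{v, - v, 1 / v, - 1 / v} \<subseteq> fourfold w"
    using v0 by (auto simp: fourfold_def power_divide add.commute)
  show ?thesis
  proof (cases "w^2 = 4")
    case True
    have "v \<noteq> - v" using v0 by (metis add_eq_0_iff mult_2 mult_eq_0_iff zero_neq_numeral)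
    then show ?thesis using Q True by (intro exI[of _ "{v, - v}"]) auto
  next
    case False
    then have "distinct [v, - v, 1 / v, - 1 / v]" using distinct_antipodal[OF v0] v by simp
    then have "card {v, - v, 1 / v, - 1 / v} = 4" by simp
    then show ?thesis using Q False by (intro exI[of _ "{v, - v, 1 / v, - 1 / v}"]) auto
  qed
qed

lemma level_level_infty: "level A B C u = level_infty A B C + 4 * (A - B) * (A - C) / (C - B) * (1 / (A - u))"
  by (simp add: level_def)

lemma level_inj:
  assumes "A \<noteq> B" "A \<noteq> C" "B \<noteq> C" "u \<noteq> A" "u' \<noteq> A"
  shows "level A B C u = level A B C u' \<longleftrightarrow> u = u'"
  using assms unfolding level_level_infty by (auto simp: frac_eq_eq)

lemma level_ne_infty:
  assumes "A \<noteq> B" "A \<noteq> C" "B \<noteq> C" "u \<noteq> A"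
  shows "level A B C u \<noteq> level_infty A B C"
  using assms unfolding level_level_infty by auto

lemma level_values:
  assumes "A \<noteq> B" "A \<noteq> C" "B \<noteq> C"
  shows "level A B C B = - 2" "level A B C C = 2"
proof -
  define i where "i = 1 / (A - B)"
  define j where "j = 1 / (A - C)"
  define k where "k = 1 / (C - B)"
  have inv: "(A - B) * i = 1" "(A - C) * j = 1" "(C - B) * k = 1"
    using assms by (simp_all add: i_def j_def k_def)
  have "level A B C B = 2 * (B + C - 2 * A) * k + 4 * (A - B) * (A - C) * k * i"
    "level A B C C = 2 * (B + C - 2 * A) * k + 4 * (A - B) * (A - C) * k * j"
    by (simp_all add: level_def level_infty_def i_def j_def k_def)
  then show "level A B C B = - 2" "level A B C C = 2" using inv by algebra+
qed

text \<open>The reflection carries the data of one curve to those of the other, so that one value v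
  serves both covers.\<close>

lemma level_reflect:
  "level_infty (4 - A) (4 - B) (4 - C) = level_infty A B C"
  "level (4 - A) (4 - B) (4 - C) (4 - u) = level A B C u"
proof -
  have "2 * ((4 - B) + (4 - C) - 2 * (4 - A)) = - (2 * (B + C - 2 * A))" "(4 - C) - (4 - B) = - (C - B)"
    by (simp_all add: algebra_simps)
  then show i: "level_infty (4 - A) (4 - B) (4 - C) = level_infty A B C"
    unfolding level_infty_def by (simp only: minus_divide_divide)
  have e: "4 * ((4 - A) - (4 - B)) * ((4 - A) - (4 - C)) = 4 * (A - B) * (A - C)"
    "((4 - C) - (4 - B)) * ((4 - A) - (4 - u)) = (C - B) * (A - u)" by algebra+
  show "level (4 - A) (4 - B) (4 - C) (4 - u) = level A B C u"
    unfolding level_def i e ..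
qed

section \<open>Counting the common torsion values\<close>

definition branch_invariant :: "cover \<Rightarrow> complex \<Rightarrow> bool" where
  "branch_invariant X J \<longleftrightarrow> (\<exists>u v w z. distinct [u, v, w, z] \<and> branch_set X = Fin ` {u, v, w, z} \<and>
     quadruple_invariant u v w z = J)"

lemma branch_invariant_PGL2:
  assumes "branch_invariant X J" "branch_invariant Y K" "\<gamma> \<in> PGL2" "\<gamma> ` branch_set X = branch_set Y"
  shows "J = K"
  using assms unfolding branch_invariant_def by (metis quadruple_invariant_PGL2)

definition suitable_covers :: "complex \<Rightarrow> (point \<Rightarrow> p1) \<Rightarrow> (point \<Rightarrow> p1) \<Rightarrow> bool" where
  "suitable_covers t \<phi> \<psi> \<longleftrightarrow>
    elliptic_curve (flex_weierstrass t) \<and> elliptic_curve (flex_weierstrass (- 4 - t)) \<and>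
    double_cover (flex_weierstrass t) \<phi> \<and> double_cover (flex_weierstrass (- 4 - t)) \<psi> \<and>
    ramified_at (flex_weierstrass t) \<phi> Origin \<and> ramified_at (flex_weierstrass (- 4 - t)) \<psi> Origin \<and>
    \<phi> ` n_torsion (flex_weierstrass t) 2 \<noteq> \<psi> ` n_torsion (flex_weierstrass (- 4 - t)) 2 \<and>
    {..<22::nat} \<lesssim> \<phi> ` torsion (flex_weierstrass t) \<inter> \<psi> ` torsion (flex_weierstrass (- 4 - t)) \<and>
    branch_invariant (flex_weierstrass t, \<phi>) (flex_invariant t) \<and>
    branch_invariant (flex_weierstrass (- 4 - t), \<psi>) (flex_invariant (- 4 - t))"

text \<open>With k different from 0 and 4, the points V, V1, V2 are distinct and none is u = 0 or u
  = 4, where the origins of the two curves lie. With k different from - t they are not among A, B,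
  C.\<close>

lemma cover_pair:
  assumes t: "t \<noteq> 0" "t \<noteq> - 4" and k: "k = V * (V - 3)^2" "k \<noteq> 0" "k \<noteq> 4" "k \<noteq> - t"
    and d: "division_abscissa t (t / V)" "division_abscissa (- 4 - t) ((- 4 - t) / (4 - V))"
  shows "\<exists>\<phi> \<psi>. suitable_covers t \<phi> \<psi>"
proof -
  define t' where "t' = - 4 - t"
  have t': "t' \<noteq> 0" "t' \<noteq> - 4" "- 4 - t' = t" using t by (auto simp: t'_def algebra_simps)
  have tm: "- t \<noteq> 0" "- t \<noteq> 4" using t by (simp, metis minus_minus)
  obtain A where A: "A * (A - 3)^2 = - t" using cubic_root_exists by blast
  have "A * (A - 3)^2 \<noteq> 0" "A * (A - 3)^2 \<noteq> 4" unfolding A using tm by simp_all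
  then obtain B C where BC: "C = 6 - A - B" "B * C = (A - 3)^2" and ABC: "A \<noteq> B" "A \<noteq> C" "B \<noteq> C"
    by (rule other_roots)
  have "V * (V - 3)^2 \<noteq> 0" "V * (V - 3)^2 \<noteq> 4" using k by simp_all
  then obtain V1 V2 where V: "V2 = 6 - V - V1" "V1 * V2 = (V - 3)^2" and VV: "V \<noteq> V1" "V \<noteq> V2" "V1 \<noteq> V2"
    by (rule other_roots)
  have root: "B * (B - 3)^2 = - t" "C * (C - 3)^2 = - t" using A BC by algebra+
  have rootV: "V1 * (V1 - 3)^2 = k" "V2 * (V2 - 3)^2 = k" using k(1) V by algebra+
  have range: "u \<noteq> 0" "4 - u \<noteq> 0" "u \<notin> {A, B, C}" if "u \<in> {V, V1, V2}" for u
  proof -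
    have u: "u * (u - 3)^2 = k" using that rootV k(1) by auto
    show "u \<noteq> 0" "4 - u \<noteq> 0" using u k by auto
    show "u \<notin> {A, B, C}" using u k A root by auto
  qed
  have rangeB: "u \<noteq> 0" "4 - u \<noteq> 0" if "u \<in> {A, B, C}" for u
  proof -
    have u: "u * (u - 3)^2 = - t" using that root A by auto
    show "u \<noteq> 0" "4 - u \<noteq> 0" using u tm by auto
  qed
  obtain \<phi> \<alpha> where \<phi>: "elliptic_curve (flex_weierstrass t)" "double_cover (flex_weierstrass t) \<phi>"
    "ramified_at (flex_weierstrass t) \<phi> Origin"
    and \<phi>2: "\<phi> ` n_torsion (flex_weierstrass t) 2 = Fin ` {\<alpha>, - \<alpha>, 1 / \<alpha>, - 1 / \<alpha>}"
    "distinct [\<alpha>, - \<alpha>, 1 / \<alpha>, - 1 / \<alpha>]" "\<alpha>^2 + 1 / \<alpha>^2 = level A B C 0"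
    "quadruple_invariant \<alpha> (- \<alpha>) (1 / \<alpha>) (- 1 / \<alpha>) = flex_invariant t"
    and \<phi>3: "Fin 0 \<in> \<phi> ` torsion (flex_weierstrass t)" "Infty \<in> \<phi> ` torsion (flex_weierstrass t)"
    "\<And>v. v \<noteq> 0 \<Longrightarrow> v^2 + 1 / v^2 = level_infty A B C \<Longrightarrow> Fin v \<in> \<phi> ` torsion (flex_weierstrass t)"
    "\<And>v u. v \<noteq> 0 \<Longrightarrow> v^2 + 1 / v^2 = level A B C u \<Longrightarrow> u \<noteq> 0 \<Longrightarrow> u \<noteq> A \<Longrightarrow> torsion_abscissa t (t / u) \<Longrightarrow>
       Fin v \<in> \<phi> ` torsion (flex_weierstrass t)"
    by (rule flex_cover[OF t BC _ ABC]) (use A in auto)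
  have BC': "4 - C = 6 - (4 - A) - (4 - B)" "(4 - B) * (4 - C) = (4 - A - 3)^2" "t' = - ((4 - A) * (4 - A - 3)^2)"
    "4 - A \<noteq> 4 - B" "4 - A \<noteq> 4 - C" "4 - B \<noteq> 4 - C"
    using BC A ABC unfolding t'_def by (simp_all, algebra+)
  obtain \<psi> \<beta> where \<psi>: "elliptic_curve (flex_weierstrass t')" "double_cover (flex_weierstrass t') \<psi>"
    "ramified_at (flex_weierstrass t') \<psi> Origin"
    and \<psi>2: "\<psi> ` n_torsion (flex_weierstrass t') 2 = Fin ` {\<beta>, - \<beta>, 1 / \<beta>, - 1 / \<beta>}"
    "distinct [\<beta>, - \<beta>, 1 / \<beta>, - 1 / \<beta>]" "\<beta>^2 + 1 / \<beta>^2 = level (4 - A) (4 - B) (4 - C) 0"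
    "quadruple_invariant \<beta> (- \<beta>) (1 / \<beta>) (- 1 / \<beta>) = flex_invariant t'"
    and \<psi>3: "Fin 0 \<in> \<psi> ` torsion (flex_weierstrass t')" "Infty \<in> \<psi> ` torsion (flex_weierstrass t')"
    "\<And>v. v \<noteq> 0 \<Longrightarrow> v^2 + 1 / v^2 = level_infty (4 - A) (4 - B) (4 - C) \<Longrightarrow> Fin v \<in> \<psi> ` torsion (flex_weierstrass t')"
    "\<And>v u. v \<noteq> 0 \<Longrightarrow> v^2 + 1 / v^2 = level (4 - A) (4 - B) (4 - C) u \<Longrightarrow> u \<noteq> 0 \<Longrightarrow> u \<noteq> 4 - A \<Longrightarrow>
       torsion_abscissa t' (t' / u) \<Longrightarrow> Fin v \<in> \<psi> ` torsion (flex_weierstrass t')"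
    by (rule flex_cover[OF t'(1,2) BC']) auto
  let ?I = "\<phi> ` torsion (flex_weierstrass t) \<inter> \<psi> ` torsion (flex_weierstrass t')"
  have d': "division_abscissa t' (t' / (4 - V))" "division_abscissa (- 4 - t') ((- 4 - t') / (4 - (4 - V)))"
    using d t' unfolding t'_def by simp_all
  have tors: "torsion_abscissa t (t / u) \<and> torsion_abscissa t' (t' / (4 - u))" if "u \<in> {B, C, V, V1, V2}" for u
  proof -
    have root': "(4 - B) * (4 - B - 3)^2 = - t'" "(4 - C) * (4 - C - 3)^2 = - t'"
      using root unfolding t'_def by algebra+
    have V': "4 - V2 = 6 - (4 - V) - (4 - V1)" "(4 - V1) * (4 - V2) = (4 - V - 3)^2"
      "4 - V1 = 6 - (4 - V) - (4 - V2)" "(4 - V2) * (4 - V1) = (4 - V - 3)^2"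
      using V by (simp, algebra)+
    have swap: "V1 = 6 - V - V2" "V2 * V1 = (V - 3)^2" using V by (simp_all add: mult.commute)
    have ne: "V \<noteq> 0" "V \<noteq> 4" "V1 \<noteq> 0" "V2 \<noteq> 0" "4 - V \<noteq> 0" "4 - V \<noteq> 4" "4 - V1 \<noteq> 0" "4 - V2 \<noteq> 0"
      using range by auto
    from that consider "u = B" | "u = C" | "u = V" | "u = V1" | "u = V2" by blast
    then show ?thesis
    proof cases
      case 1 then show ?thesis using torsion_abscissa_root t t' root root' by blast
    next
      case 2 then show ?thesis using torsion_abscissa_root t t' root root' by blast
    next
      case 3 then show ?thesis using torsion_abscissa_of_division t t' d d' by blast
    next
      case 4 then show ?thesis
        using torsion_abscissa_partner[OF t V ne(1-4) d] torsion_abscissa_partner[OF t'(1,2) V'(1,2) ne(5-8) d'] by blast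
    next
      case 5 then show ?thesis
        using torsion_abscissa_partner[OF t swap ne(1,2,4,3) d] torsion_abscissa_partner[OF t'(1,2) V'(3,4) ne(5,6,8,7) d'] by blast
    qed
  qed
  \<comment> \<open>A is the pole of \<open>level\<close>; its two values \<open>Fin 0\<close> and
    \<open>Infty\<close> join in \<open>S\<close>. Of the six values in W, those at B and C have two
    preimages each and the others four.\<close>
  define W where "W = insert (level_infty A B C) (level A B C ` {B, C, V, V1, V2})"
  have in_I: "Fin v \<in> ?I" if "v \<in> fourfold w" and wW: "w \<in> W" for v w
  proof -
    have v: "v \<noteq> 0" "v^2 + 1 / v^2 = w" using that by (auto simp: fourfold_def)
    show ?thesis
    proof (cases "w = level_infty A B C")
      case True
      then show ?thesis using \<phi>3(3) \<psi>3(3) v level_reflect(1) by simp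
    next
      case False
      then obtain u where u: "u \<in> {B, C, V, V1, V2}" "w = level A B C u" using wW by (auto simp: W_def)
      have nz: "u \<noteq> 0" "4 - u \<noteq> 0" "u \<noteq> A" using u(1) range rangeB ABC by blast+
      then show ?thesis using \<phi>3(4)[of v u] \<psi>3(4)[of v "4 - u"] v u tors[OF u(1)] level_reflect(2) by simp
    qed
  qed
  obtain Q where Q: "\<And>w. Q w \<subseteq> fourfold w" "\<And>w. finite (Q w)" "\<And>w. card (Q w) = (if w^2 = 4 then 2 else 4)"
    using fourfold_card by metis
  define S where "S = insert (Fin 0) (insert Infty (Fin ` (\<Union>w\<in>W. Q w)))"
  have "Fin ` (\<Union>w\<in>W. Q w) \<subseteq> ?I" using in_I Q(1) by blast
  moreover have "Fin 0 \<in> ?I" "Infty \<in> ?I" using \<phi>3(1,2) \<psi>3(1,2) by blast+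
  ultimately have "S \<subseteq> ?I" unfolding S_def by blast
  have finW: "finite W" by (simp add: W_def)
  have cardS: "card S = 22"
  proof -
    have A': "u \<noteq> A" if "u \<in> {B, C, V, V1, V2}" for u using that range ABC by blast
    have 1: "level_infty A B C \<notin> level A B C ` {B, C, V, V1, V2}"
      using level_ne_infty[OF ABC] A' by (metis imageE)
    have inj: "inj_on (level A B C) {B, C, V, V1, V2}"
      using level_inj[OF ABC] A' by (auto simp only: inj_on_def)
    have sq: "w^2 = 4 \<longleftrightarrow> w = level A B C B \<or> w = level A B C C" for w
    proof -
      have "w^2 = 4 \<longleftrightarrow> w^2 = 2^2" by simp
      then show ?thesis unfolding level_values[OF ABC] power2_eq_iff by blast
    qed
    have sq_u: "(level A B C u)^2 = 4 \<longleftrightarrow> u = B \<or> u = C" if "u \<in> {B, C, V, V1, V2}" for u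
      unfolding sq using level_inj[OF ABC] A' that by blast
    have "(level_infty A B C)^2 \<noteq> 4" unfolding sq using 1 by auto
    have ne: "B \<noteq> V" "B \<noteq> V1" "B \<noteq> V2" "C \<noteq> V" "C \<noteq> V1" "C \<noteq> V2" using range by blast+
    have "card (\<Union>w\<in>W. Q w) = (\<Sum>w\<in>W. card (Q w))"
    proof (rule card_UN_disjoint[OF finW])
      show "\<forall>i\<in>W. finite (Q i)" using Q by blast
      show "\<forall>i\<in>W. \<forall>j\<in>W. i \<noteq> j \<longrightarrow> Q i \<inter> Q j = {}" using Q(1) unfolding fourfold_def by blast
    qed
    also have "\<dots> = 4 + (\<Sum>w\<in>level A B C ` {B, C, V, V1, V2}. card (Q w))"
      unfolding W_def using 1 \<open>(level_infty A B C)^2 \<noteq> 4\<close> Q(3) by (subst sum.insert) auto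
    also have "(\<Sum>w\<in>level A B C ` {B, C, V, V1, V2}. card (Q w)) = (\<Sum>u\<in>{B, C, V, V1, V2}. card (Q (level A B C u)))"
      by (simp only: sum.reindex[OF inj] o_def)
    also have "\<dots> = (\<Sum>u\<in>{B, C, V, V1, V2}. if u = B \<or> u = C then 2 else 4)"
      by (intro sum.cong refl) (simp only: Q(3) sq_u)
    also have "\<dots> = 16" using ABC(3) VV ne by (simp add: ne[symmetric])
    finally have "card (\<Union>w\<in>W. Q w) = 20" by simp
    then have "card (Fin ` (\<Union>w\<in>W. Q w)) = 20" by (subst card_image) (auto simp: inj_on_def)
    moreover have "0 \<notin> (\<Union>w\<in>W. Q w)" using Q(1) by (auto simp: fourfold_def)
    moreover have "finite (Fin ` (\<Union>w\<in>W. Q w))" using Q(2) finW by blast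
    ultimately show ?thesis unfolding S_def by (subst card_insert_disjoint; (subst card_insert_disjoint)?) auto
  qed
  have "{..<22::nat} \<lesssim> ?I"
  proof -
    have "finite S" using cardS card.infinite by fastforce
    then have "{..<22::nat} \<lesssim> S" using cardS by (simp add: lepoll_iff_card_le)
    then show ?thesis using subset_imp_lepoll[OF \<open>S \<subseteq> ?I\<close>] by (rule lepoll_trans)
  qed
  moreover have "\<phi> ` n_torsion (flex_weierstrass t) 2 \<noteq> \<psi> ` n_torsion (flex_weierstrass t') 2"
  proof
    assume "\<phi> ` n_torsion (flex_weierstrass t) 2 = \<psi> ` n_torsion (flex_weierstrass t') 2"
    \<comment> \<open>All members of a branch set have the same v^2 + 1 / v^2. Equal branch sets
      would thus identify the fourth branch points u = 0 and u = 4 of the two abscissa maps.\<close>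
    then have "\<alpha> \<in> {\<beta>, - \<beta>, 1 / \<beta>, - 1 / \<beta>}" unfolding \<phi>2 \<psi>2 by auto
    then have "\<alpha>^2 + 1 / \<alpha>^2 = \<beta>^2 + 1 / \<beta>^2" by (auto simp: power_divide add.commute)
    moreover have "level (4 - A) (4 - B) (4 - C) 0 = level A B C 4" using level_reflect(2)[of A B C 4] by simp
    ultimately have "level A B C 0 = level A B C 4" unfolding \<phi>2 \<psi>2 by simp
    then show False using level_inj[OF ABC] rangeB by auto
  qed
  moreover have "branch_invariant (flex_weierstrass t, \<phi>) (flex_invariant t)"
    "branch_invariant (flex_weierstrass t', \<psi>) (flex_invariant t')"
    unfolding branch_invariant_def branch_set_def prod.case using \<phi>2 \<psi>2 by blast+
  ultimately show ?thesis using \<phi> \<psi> unfolding suitable_covers_def t'_def[symmetric] by blast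
qed

section \<open>Infinitely many essentially distinct pairs\<close>

lemma finite_flex_invariant_fibre: "finite {t. t \<noteq> 0 \<and> t \<noteq> - 4 \<and> flex_invariant t = J}"
proof -
  define p where "p = smult J ([:0, 1:]^3 * [:4, 1:]) + smult 216 ([:9, 2:]^3)"
  have p: "poly p t = J * (t^3 * (t + 4)) + 216 * (9 + 2 * t)^3" for t
    by (simp add: p_def algebra_simps)
  \<comment> \<open>At t = 0 the term with J drops out and 216 * 9^3 remains, whatever J is.\<close>
  have "poly p 0 \<noteq> 0" unfolding p by simp
  then have "p \<noteq> 0" by auto
  then have "finite {t. poly p t = 0}" by (rule poly_roots_finite)
  moreover have "{t. t \<noteq> 0 \<and> t \<noteq> - 4 \<and> flex_invariant t = J} \<subseteq> {t. poly p t = 0}"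
  proof
    fix t assume "t \<in> {t. t \<noteq> 0 \<and> t \<noteq> - 4 \<and> flex_invariant t = J}"
    then have t: "t \<noteq> 0" "t + 4 \<noteq> 0" and J: "J = flex_invariant t" by (auto simp: add_eq_0_iff2)
    have "t^3 * (t + 4) \<noteq> 0" using t by simp
    then have "J * (t^3 * (t + 4)) = - 216 * (9 + 2 * t)^3" unfolding J flex_invariant_def by simp
    then show "t \<in> {t. poly p t = 0}" by (simp add: p)
  qed
  ultimately show ?thesis by (rule rev_finite_subset)
qed

lemma infinite_section:
  assumes "infinite M" "\<And>x. x \<in> M \<Longrightarrow> finite {y \<in> M. h y = h x}"
  obtains N where "N \<subseteq> M" "infinite N" "inj_on h N"
proof -
  have "infinite (h ` M)"
  proof
    assume "finite (h ` M)"
    then obtain z where "z \<in> h ` M" "infinite (h -` {z} \<inter> M)"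
      using inf_img_fin_dom'[OF _ assms(1)] by blast
    moreover then obtain x where "x \<in> M" "z = h x" by blast
    moreover have "h -` {h x} \<inter> M = {y \<in> M. h y = h x}" by blast
    ultimately show False using assms(2) by auto
  qed
  obtain N where N: "N \<subseteq> M" "inj_on h N" "h ` M = h ` N"
    using subset_image_inj[of "h ` M" h M] by auto
  then have "infinite N" using \<open>infinite (h ` M)\<close> by auto
  then show ?thesis using N that by blast
qed

lemma id_in_PGL2: "id \<in> PGL2"
proof -
  have "moebius 1 0 0 1 x = id x" for x by (cases x) (simp_all add: hpt_def)
  then have "moebius 1 0 0 1 = id" by blast
  moreover have "1 * 1 - 0 * 0 \<noteq> (0::complex)" by simp
  ultimately show ?thesis unfolding PGL2_def by (metis (mono_tags, lifting) mem_Collect_eq)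
qed

lemma essentially_same_invariants:
  assumes "essentially_same p q" "branch_invariant (fst p) J1" "branch_invariant (snd p) J2"
    "branch_invariant (fst q) K1" "branch_invariant (snd q) K2"
  shows "{J1, J2} = {K1, K2}"
proof -
  note eq = branch_invariant_PGL2
  obtain \<gamma> where "\<gamma> \<in> PGL2" and "\<gamma> ` branch_set (fst p) = branch_set (fst q) \<and> \<gamma> ` branch_set (snd p) = branch_set (snd q) \<or>
      \<gamma> ` branch_set (fst p) = branch_set (snd q) \<and> \<gamma> ` branch_set (snd p) = branch_set (fst q)"
    using assms(1) unfolding essentially_same_def by (elim bexE) (rule that)
  then consider "J1 = K1" "J2 = K2" | "J1 = K2" "J2 = K1"
    using eq[OF assms(2,4)] eq[OF assms(3,5)] eq[OF assms(2,5)] eq[OF assms(3,4)] by metis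
  then show ?thesis by cases auto
qed

text \<open>At m = 2 the value V = m + 1 = 3 would lie in the degenerate fibre k = 0.\<close>

definition torsion_parameters :: "real set" where
  "torsion_parameters = {m. 0 < m \<and> m < 3 \<and> m \<noteq> 2 \<and> (\<exists>k. doubling_iterate k m = 0)}"

text \<open>For this parameter the point with coordinate u = m + 1 has order 3 on the first curve, while
  on the second one its abscissa is 4 m^3 / (3 - m).\<close>

definition parameter :: "real \<Rightarrow> complex" where
  "parameter m = complex_of_real (- 4 - 4 * m^3)"

lemma infinite_torsion_parameters: "infinite torsion_parameters"
proof -
  have "torsion_parameters = {m. 0 < m \<and> m < 3 \<and> (\<exists>k. doubling_iterate k m = 0)} - {2}" by (auto simp: torsion_parameters_def)
  then show ?thesis using Diff_infinite_finite[OF _ infinite_zeros_of_iterates, of "{2}"] by simp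
qed

lemma parameter_ne: "m \<in> torsion_parameters \<Longrightarrow> parameter m \<noteq> 0" "m \<in> torsion_parameters \<Longrightarrow> parameter m \<noteq> - 4"
proof -
  assume "m \<in> torsion_parameters"
  then have "m^3 > 0" by (simp add: torsion_parameters_def)
  then have "- 4 - 4 * m^3 \<noteq> 0" "- 4 - 4 * m^3 \<noteq> - 4" by linarith+
  then show "parameter m \<noteq> 0" "parameter m \<noteq> - 4"
    using of_real_eq_iff[of "- 4 - 4 * m^3" "- 4", where 'a = complex] of_real_eq_0_iff[of "- 4 - 4 * m^3", where 'a = complex]
    unfolding parameter_def by (simp_all del: of_real_diff of_real_mult of_real_eq_iff of_real_eq_0_iff)
qed

text \<open>Apart from 0, the abscissae of order 3 are the roots of x^3 + 12 x^2 - 12 t x + 4 t^2.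
  In terms of u = t / x this reads 4 (u - 1)^3 = - 4 - t, so writing - 4 - t as 4 z^3 gives the root
  u = z + 1.\<close>

lemma division_abscissa_order_three:
  fixes z :: complex
  assumes t: "t = - 4 - 4 * z^3" and z: "z + 1 \<noteq> 0"
  shows "division_abscissa t (t / (z + 1))"
proof -
  define x where "x = - 4 * (z^2 - z + 1)"
  have tx: "t = (z + 1) * x" unfolding t x_def by algebra
  then have q: "t / (z + 1) = x" using z by simp
  have "x^3 + 12 * t * x - 8 * t^2 = 4 * flex_cubic t x"
    unfolding flex_cubic_def tx x_def by algebra
  then show ?thesis unfolding q
    by (cases "flex_cubic t x = 0") (auto simp: flex_double_def intro: division_abscissa.two division_abscissa.three)
qed

lemma cover_pair_of_torsion_parameter:
  assumes "m \<in> torsion_parameters"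
  shows "\<exists>\<phi> \<psi>. suitable_covers (parameter m) \<phi> \<psi>"
proof -
  define t where "t = parameter m"
  obtain k where m: "0 < m" "m < 3" "m \<noteq> 2" and k: "doubling_iterate k m = 0" using assms by (auto simp: torsion_parameters_def)
  define z where "z = complex_of_real m"
  have tz: "t = - 4 - 4 * z^3" by (simp add: t_def parameter_def z_def)
  have ofr: "z + c \<noteq> 0" if "m + d \<noteq> 0" "c = complex_of_real d" for c d
    using that unfolding z_def by (metis of_real_add of_real_eq_0_iff)
  have nz: "z \<noteq> 0" "z + 1 \<noteq> 0" "z - 2 \<noteq> 0" "z - 3 \<noteq> 0"
    using m ofr[of 0 0] ofr[of 1 1] ofr[of "- 2" "- 2"] ofr[of "- 3" "- 3"] by auto
  let ?k = "(z + 1) * (z + 1 - 3)^2"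
  show ?thesis unfolding t_def[symmetric]
  proof (rule cover_pair)
    show "t \<noteq> 0" "t \<noteq> - 4" using parameter_ne assms by (auto simp: t_def)
    show "?k = (z + 1) * (z + 1 - 3)^2" ..
    show "?k \<noteq> 0" using nz by simp
    show "?k \<noteq> 4"
    proof
      assume "?k = 4"
      moreover have "(z - 3) * z^2 = ?k - 4" by algebra
      ultimately have "(z - 3) * z^2 = 0" by simp
      then show False using nz by simp
    qed
    show "?k \<noteq> - t"
    proof
      assume "?k = - t"
      moreover have "(z + 1) * (3 * z^2) = - (?k - (- t))" unfolding tz by algebra
      ultimately have "(z + 1) * (3 * z^2) = 0" by simp
      then show False using nz by simp
    qed
    show "division_abscissa t (t / (z + 1))" by (rule division_abscissa_order_three[OF tz nz(2)])
    have "division_abscissa (complex_of_real (4 * m^3)) (complex_of_real (4 * m^3 / (3 - m)))"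
      using k unfolding doubling_iterate_def by (rule division_abscissa_of_iterate)
    moreover have "complex_of_real (4 * m^3) = - 4 - t" "complex_of_real (4 * m^3 / (3 - m)) = (- 4 - t) / (4 - (z + 1))"
      by (simp_all add: tz z_def)
    ultimately show "division_abscissa (- 4 - t) ((- 4 - t) / (4 - (z + 1)))" by (simp only:)
  qed
qed

lemma inj_on_parameter: "inj_on parameter torsion_parameters"
proof (rule inj_onI)
  fix m n assume mn: "m \<in> torsion_parameters" "n \<in> torsion_parameters" "parameter m = parameter n"
  then have "m^3 = n^3" unfolding parameter_def of_real_eq_iff by simp
  then show "m = n" using mn by (intro power_eq_imp_eq_base[of m 3 n]) (auto simp: torsion_parameters_def)
qed

theorem theorem2:
  "\<exists>S :: (cover \<times> cover) set. infinite S \<and>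
     pairwise (\<lambda>p q. \<not> essentially_same p q) S \<and>
     (\<forall>((E1, \<pi>1), (E2, \<pi>2)) \<in> S.
        elliptic_curve E1 \<and> elliptic_curve E2 \<and>
        double_cover E1 \<pi>1 \<and> double_cover E2 \<pi>2 \<and>
        ramified_at E1 \<pi>1 Origin \<and> ramified_at E2 \<pi>2 Origin \<and>
        \<pi>1 ` n_torsion E1 2 \<noteq> \<pi>2 ` n_torsion E2 2 \<and>
        {..<22::nat} \<lesssim> \<pi>1 ` torsion E1 \<inter> \<pi>2 ` torsion E2)"
proof -
  \<comment> \<open>A set and not an ordered pair, since \<open>essentially_same\<close> allows the
    two covers to be interchanged.\<close>
  define h where "h m = {flex_invariant (parameter m), flex_invariant (- 4 - parameter m)}" for m
  have "finite {n \<in> torsion_parameters. h n = h m}" for m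
  proof -
    let ?F = "\<Union>J\<in>h m. {t. t \<noteq> 0 \<and> t \<noteq> - 4 \<and> flex_invariant t = J}"
    have "parameter ` {n \<in> torsion_parameters. h n = h m} \<subseteq> ?F"
      using parameter_ne by (auto simp: h_def)
    moreover have "finite ?F" using finite_flex_invariant_fibre by (auto simp: h_def)
    ultimately have "finite (parameter ` {n \<in> torsion_parameters. h n = h m})" by (rule finite_subset)
    then show ?thesis
      by (rule finite_imageD) (rule inj_on_subset[OF inj_on_parameter], auto)
  qed
  then obtain N where N: "N \<subseteq> torsion_parameters" "infinite N" "inj_on h N"
    using infinite_section[OF infinite_torsion_parameters, of h] by blast
  obtain \<Phi> \<Psi> where P: "\<And>m. m \<in> torsion_parameters \<Longrightarrow> suitable_covers (parameter m) (\<Phi> m) (\<Psi> m)"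
    using cover_pair_of_torsion_parameter by metis
  define pair where "pair m = ((flex_weierstrass (parameter m), \<Phi> m), (flex_weierstrass (- 4 - parameter m), \<Psi> m))" for m
  have same: "m = n" if "m \<in> N" "n \<in> N" "essentially_same (pair m) (pair n)" for m n
  proof -
    have "h m = h n"
      unfolding h_def using that(3) by (rule essentially_same_invariants) (use P that(1,2) N(1) in \<open>auto simp: pair_def suitable_covers_def\<close>)
    then show ?thesis using N(3) that(1,2) by (simp add: inj_on_def)
  qed
  \<comment> \<open>Reflexivity makes \<open>pair\<close> injective on N: equal pairs are
    essentially the same, hence have equal parameters.\<close>
  have same_refl: "essentially_same p p" for p
    unfolding essentially_same_def by (intro bexI[of _ id] id_in_PGL2) simp
  have "inj_on pair N" using same same_refl by (metis inj_onI)
  then have "infinite (pair ` N)" using N(2) finite_imageD by blast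
  moreover have "pairwise (\<lambda>p q. \<not> essentially_same p q) (pair ` N)"
    unfolding pairwise_def using same by blast
  moreover have "\<forall>((E1, \<pi>1), (E2, \<pi>2)) \<in> pair ` N.
        elliptic_curve E1 \<and> elliptic_curve E2 \<and>
        double_cover E1 \<pi>1 \<and> double_cover E2 \<pi>2 \<and>
        ramified_at E1 \<pi>1 Origin \<and> ramified_at E2 \<pi>2 Origin \<and>
        \<pi>1 ` n_torsion E1 2 \<noteq> \<pi>2 ` n_torsion E2 2 \<and>
        {..<22::nat} \<lesssim> \<pi>1 ` torsion E1 \<inter> \<pi>2 ` torsion E2"
    unfolding ball_simps pair_def prod.case using P[OF subsetD[OF N(1)]] unfolding suitable_covers_def by blast
  ultimately show ?thesis by blast
qed

end
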